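(* Let $f(z)=z+a_2z^2+a_3z^3+\cdots$ be a function in $\mathcal{S}$, and suppose that all the coefficients $a_n$ ($n\ge 2$) are half-integers. Then $f$ is either one of the nine functions $$ z,\quad \frac{z}{1\pm z},\quad \frac{z}{1\pm z^2},\quad \frac{z}{(1\pm z)^2},\quad \frac{z}{1\pm z+z^2}, $$ or else one of the following twelve functions: $$ z\pm\frac{z^2}{2},\quad \frac{z(2\pm z)}{2(1\pm z)},\quad \frac{z(2\pm z^2)}{2(1\pm z^2)},\quad \frac{z(2\pm z)}{2(1-z^2)},\quad \frac{z(2\pm z)}{2(1\pm z)^2},\quad \frac{z(2\pm z+z^2)}{2(1\pm z+z^2)}. $$ In each expression all the signs $\pm$ are taken to be the same (all upper or all lower), so that each expression containing $\pm$ denotes exactly two functions.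
   Context: Let $\mathbb{D}=\{z\in\mathbb{C}:|z|<1\}$. Let $\mathcal{A}$ be the set of analytic functions $f$ on $\mathbb{D}$ with $f(0)=0$ and $f'(0)=1$, and let $\mathcal{S}$ be the set of univalent (i.e. injective) functions in $\mathcal{A}$. A half-integer means the half of an integer, i.e. an element of $\frac12\mathbb{Z}=\{n/2:n\in\mathbb{Z}\}$; in particular every integer is a half-integer. *)

theory Defs
  imports "HOL-Complex_Analysis.Complex_Analysis"
begin

abbreviation unit_disc :: "complex set" where
  "unit_disc \<equiv> ball 0 1"

definition class_A :: "(complex \<Rightarrow> complex) set" where
  "class_A = {f. f analytic_on unit_disc \<and> f 0 = 0 \<and> deriv f 0 = 1}"

definition class_S :: "(complex \<Rightarrow> complex) set" where
  "class_S = {f \<in> class_A. inj_on f unit_disc}"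

text \<open>Every integer is a half-integer here: the numerator need not be odd.\<close>

definition half_integers :: "complex set" where
  "half_integers = {of_int n / 2 | n :: int. True}"

end

theory Submission
  imports Defs
begin

text \<open>
Write \<open>f(z) = z A(z)\<close> and \<open>z / f(z) = G(z) = 1/A(z)\<close>.  Since \<open>f\<close> is univalent, \<open>1/f\<close> maps the disc onto
the complement in the Riemann sphere of a compact set, whose area is nonnegative, and Gronwall's area theorem says that
\<open>\<Sum> (k - 1) |G\<^sub>k|\<^sup>2 \<le> 1\<close>.  The half-integrality of \<open>A\<close> makes this inequality extremely restrictive: by \<open>A G = 1\<close>,
once \<open>G\<^sub>1, \<dots>, G\<^sub>k\<^sub>-\<^sub>1\<close> are given, the coefficient \<open>G\<^sub>k\<close> is confined to a coset of \<open>\<int>/2\<close>, and it must satisfy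
\<open>|G\<^sub>k| \<le> 1 / sqrt (k - 1)\<close>.  There are thus few choices at each step, and soon at most one.

The proof combines three ingredients.

  \<^item> The area theorem (\<open>area_theorem\<close>).  In place of Green's theorem, the area of the image of an annulus
    \<open>r < |z| < \<rho>\<close> is bounded from below by the change of variables formula and a Bessel inequality, and from
    above by the maximum principle: the image lies in the convex hull of the image of the small circle
    \<open>|z| = r\<close>, which is almost an ellipse.  A real-linear map turns this ellipse into a disc.

  \<^item> A finite search (\<open>survivors\<close>).  The inequality leaves finitely many possibilities for \<open>|a\<^sub>2|\<close>
    (\<open>second_coefficient_bound\<close>), and \<open>a\<^sub>2 \<ge> 0\<close> may be assumed after passing to \<open>-f(-z)\<close>.
    Then exactly 41 beginnings \<open>A\<^sub>0, \<dots>, A\<^sub>1\<^sub>2\<close> are compatible with the area theorem.  Each of them is the beginning of a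
    rational function \<open>P / (2 Q)\<close> with small integral coefficients (\<open>survivors_explained\<close>).

  \<^item> Rigidity (\<open>quotient_rigidity\<close>).  The series \<open>2 A Q - P\<close> has integral coefficients, while its first
    nonzero coefficient equals, up to sign, a coefficient of \<open>P G\<close>, which the area theorem makes smaller
    than 1.  Hence \<open>2 A Q = P\<close>, and \<open>f\<close> is one of 41 explicit rational functions.

Of these 41 functions, 16 have a pole in the interval \<open>(0, 1)\<close>, ten have a critical point in the disc, and two
take equal values at two complex conjugate points.  The remaining 13 functions, with their reflections
\<open>-f(-z)\<close>, are the 21 functions of the theorem.
\<close>

unbundle no fps_syntax

section \<open>Images of annuli under reciprocals of univalent functions\<close>

lemma class_S_D:
  assumes "f \<in> class_S"
  shows "f holomorphic_on unit_disc" "f 0 = 0" "deriv f 0 = 1" "inj_on f unit_disc"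
  using assms by (auto simp: class_S_def class_A_def analytic_imp_holomorphic)

text \<open>If \<open>1/f(w)\<close> lay outside a half-plane containing the image of the circle \<open>|z| = r\<close>, then
\<open>1 / (1/f - 1/f(w))\<close> would be holomorphic in \<open>|z| \<le> r\<close>, because \<open>f\<close> takes the value \<open>f(w)\<close> only at \<open>w\<close>.
It would have values in an open half-plane bounded by a line through 0 on the circle, but the value 0 at the centre,
against the maximum principle.  Applied to all half-planes, the lemma says that \<open>1/f\<close> maps \<open>r < |z| < 1\<close> into the
convex hull of the image of the circle.\<close>

lemma reciprocal_in_half_plane:
  fixes f :: "complex \<Rightarrow> complex"
  assumes holo: "f holomorphic_on ball 0 1" and f0: "f 0 = 0" and inj: "inj_on f (ball 0 1)"
    and r: "0 < r" "r < norm w" "norm w < 1"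
    and bd: "\<And>z. norm z = r \<Longrightarrow> Re (k / f z) \<le> B"
  shows "Re (k / f w) \<le> B"
proof (rule ccontr)
  assume "\<not> Re (k / f w) \<le> B"
  hence gt: "Re (k / f w) > B" by simp
  have fnz: "f z \<noteq> 0" if "z \<noteq> 0" "norm z < 1" for z
    using inj_onD[OF inj, of z 0] f0 that by auto
  \<comment> \<open>This is \<open>1 / (k (1/f(z) - 1/f(w)))\<close>, written without the pole at 0.\<close>
  define H where "H = (\<lambda>z. f z / (k * (1 - f z / f w)))"
  have neg: "k \<noteq> 0 \<and> Re (H z) < 0" if "norm z = r" for z
  proof -
    define y where "y = k * (1 / f z - 1 / f w)"
    have "f z \<noteq> 0" using fnz[of z] that r by auto
    have "Re y < 0" using bd[OF that] gt by (simp add: y_def algebra_simps)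
    hence "k \<noteq> 0" "y \<noteq> 0" by (auto simp: y_def)
    have "H z = 1 / y"
      using \<open>f z \<noteq> 0\<close> by (simp add: H_def y_def field_simps)
    moreover have "Re (1 / y) < 0"
      using \<open>Re y < 0\<close> \<open>y \<noteq> 0\<close> 
      by (auto simp: Re_divide intro!: divide_neg_pos) (smt (verit) sum_power2_gt_zero_iff)
    ultimately show ?thesis using \<open>k \<noteq> 0\<close> by simp
  qed
  have k: "k \<noteq> 0" using neg[of "of_real r"] r by simp
  have ne: "1 - f z / f w \<noteq> 0" if "norm z \<le> r" for z
  proof
    assume "1 - f z / f w = 0"
    hence "f z = f w" using fnz[of w] r by (auto simp: field_simps)
    hence "z = w" using inj_onD[OF inj] that r by auto
    thus False using that r by simp
  qed
  have holH: "H holomorphic_on cball 0 r"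
    unfolding H_def using ne k fnz[of w] r
    by (intro holomorphic_intros holomorphic_on_subset[OF holo]) auto
  have contH: "continuous_on (cball 0 r) H"
    using holH by (rule holomorphic_on_imp_continuous_on)
  have "\<exists>x\<in>sphere (0::complex) r. \<forall>y\<in>sphere 0 r. Re (H y) \<le> Re (H x)"
    by (rule continuous_attains_sup)
       (use r in \<open>auto intro!: continuous_intros continuous_on_subset[OF contH]\<close>)
  then obtain x where x: "norm x = r" "\<And>y. norm y = r \<Longrightarrow> Re (H y) \<le> Re (H x)"
    by (auto simp: dist_norm)
  have "Re (H 0) \<le> Re (H x)"
  proof (rule maximum_real_frontier[of H "cball 0 r"])
    show "H holomorphic_on interior (cball 0 r)"
      using holH by (rule holomorphic_on_subset) auto
    show "continuous_on (closure (cball 0 r)) H" using contH by simp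
  qed (use r x in \<open>auto simp: dist_norm\<close>)
  moreover have "H 0 = 0" by (simp add: H_def f0)
  ultimately show False using neg[OF x(1)] by simp
qed

section \<open>Mean values on circles and a Bessel inequality\<close>

lemma circle_mean_value:
  assumes holo: "h holomorphic_on ball 0 1" and \<rho>: "0 < \<rho>" "\<rho> < 1"
  shows "((\<lambda>t. h (of_real \<rho> * cis t)) has_integral of_real (2 * pi) * h 0) {0..2*pi}"
proof -
  have "((\<lambda>u. h u / (u - 0)) has_contour_integral 2 * of_real pi * \<i> * h 0) (circlepath 0 \<rho>)"
  proof (rule Cauchy_integral_circlepath_simple)
    show "h holomorphic_on cball 0 \<rho>"
      by (rule holomorphic_on_subset[OF holo]) (use \<rho> in auto)
  qed (use \<rho> in auto)
  hence "((\<lambda>t. h (0 + of_real \<rho> * cis t) / (0 + of_real \<rho> * cis t - 0) * of_real \<rho> * \<i> * cis t)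
            has_integral 2 * of_real pi * \<i> * h 0) {0..2*pi}"
    unfolding circlepath_def by (subst (asm) has_contour_integral_part_circlepath_iff) auto
  hence "((\<lambda>t. h (0 + of_real \<rho> * cis t) / (0 + of_real \<rho> * cis t - 0) * of_real \<rho> * \<i> * cis t * (-\<i>))
            has_integral 2 * of_real pi * \<i> * h 0 * (-\<i>)) {0..2*pi}"
    by (rule has_integral_mult_left)
  also have "2 * of_real pi * \<i> * h 0 * (-\<i>) = of_real (2 * pi) * h 0"
    by (simp add: mult_ac)
  finally show ?thesis
  proof (rule has_integral_eq[rotated])
    fix t
    show "h (0 + of_real \<rho> * cis t) / (0 + of_real \<rho> * cis t - 0) * of_real \<rho> * \<i> * cis t * (-\<i>) =
            h (of_real \<rho> * cis t)"
      using \<rho> by (simp add: mult.assoc)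
  qed
qed

lemma continuous_on_circle:
  assumes "u holomorphic_on ball 0 1" "0 < \<rho>" "\<rho> < 1"
  shows "continuous_on A (\<lambda>t. u (of_real \<rho> * cis t))"
  using assms by (intro continuous_on_compose2[OF holomorphic_on_imp_continuous_on[OF assms(1)]])
     (auto intro!: continuous_intros simp: norm_mult)

text \<open>Splitting off the constant term of a power series is the induction step in the next lemma and in
\<open>taylor_remainder_at_0\<close>.\<close>

lemma divided_difference_at_0:
  assumes holo: "u holomorphic_on ball 0 1" and exp: "u has_fps_expansion U"
  obtains v where "v holomorphic_on ball 0 1" "v has_fps_expansion fps_shift 1 U"
    "\<And>z. u z = u 0 + z * v z"
proof -
  define v where "v = (\<lambda>z. if z = 0 then deriv u 0 else (u z - u 0) / (z - 0))"
  have v: "v holomorphic_on ball 0 1"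
    unfolding v_def by (rule pole_lemma_open[OF holo]) auto
  have u: "u z = u 0 + z * v z" for z by (auto simp: v_def)
  have "v analytic_on {0}" using holomorphic_on_imp_analytic_at[OF v, of 0] by simp
  then obtain V where V: "v has_fps_expansion V"
    using analytic_at_imp_has_fps_expansion_0 by blast
  have "(\<lambda>z. u 0 + z * v z) has_fps_expansion fps_const (u 0) + fps_X * V"
    by (intro fps_expansion_intros V)
  hence "u has_fps_expansion fps_const (u 0) + fps_X * V"
    unfolding u[symmetric] .
  hence "U = fps_const (u 0) + fps_X * V"
    using exp fps_expansion_unique_complex by blast
  hence "fps_shift 1 U = V" by (simp add: fps_eq_iff)
  with V have "v has_fps_expansion fps_shift 1 U" by simp
  with v u that show ?thesis by blast
qed

text \<open>By induction: write \<open>u(z) = u(0) + z v(z)\<close>.  The mixed term in \<open>|u|\<^sup>2\<close> is the real part of a holomorphic function that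
vanishes at 0, so its mean over the circle vanishes, and \<open>v\<close> has the shifted coefficients.\<close>

lemma circle_Bessel:
  assumes holo: "u holomorphic_on ball 0 1" and \<rho>: "0 < \<rho>" "\<rho> < 1"
    and exp: "u has_fps_expansion U"
  shows "2 * pi * (\<Sum>k<N. (cmod (fps_nth U k))\<^sup>2 * \<rho> ^ (2 * k))
           \<le> integral {0..2*pi} (\<lambda>t. (cmod (u (of_real \<rho> * cis t)))\<^sup>2)"
  using holo exp
proof (induction N arbitrary: u U)
  case (Suc N)
  obtain v where v: "v holomorphic_on ball 0 1" and vexp: "v has_fps_expansion fps_shift 1 U"
    and u: "\<And>z. u z = u 0 + z * v z"
    using divided_difference_at_0[OF Suc.prems] by blast
  have U0: "fps_nth U 0 = u 0"
    using Suc.prems(2) by (rule has_fps_expansion_imp_0_eq_fps_nth_0[symmetric])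
  define I where "I = integral {0..2*pi} (\<lambda>t. (cmod (v (of_real \<rho> * cis t)))\<^sup>2)"
  have contv: "continuous_on {0..2*pi} (\<lambda>t. v (of_real \<rho> * cis t))"
    using v \<rho> by (rule continuous_on_circle)
  have "((\<lambda>t. (cmod (v (of_real \<rho> * cis t)))\<^sup>2) has_integral I) {0..2*pi}"
    unfolding I_def by (intro integrable_integral integrable_continuous_real continuous_intros contv)
  moreover have "((\<lambda>t. (\<lambda>z. cnj (u 0) * (z * v z)) (of_real \<rho> * cis t)) has_integral
        of_real (2 * pi) * (cnj (u 0) * (0 * v 0))) {0..2*pi}"
    using v \<rho> by (intro circle_mean_value) (auto intro!: holomorphic_intros)
  hence "((\<lambda>t. Re (cnj (u 0) * ((of_real \<rho> * cis t) * v (of_real \<rho> * cis t)))) has_integral 0) {0..2*pi}"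
    by (drule_tac has_integral_Re) simp
  moreover have "((\<lambda>t. (cmod (u 0))\<^sup>2) has_integral 2 * pi * (cmod (u 0))\<^sup>2) {0..2*pi}"
    using has_integral_const_real[of "(cmod (u 0))\<^sup>2" 0 "2*pi"] by simp
  ultimately have "((\<lambda>t. (cmod (u 0))\<^sup>2 + \<rho>\<^sup>2 * (cmod (v (of_real \<rho> * cis t)))\<^sup>2 +
       2 * Re (cnj (u 0) * ((of_real \<rho> * cis t) * v (of_real \<rho> * cis t)))) has_integral
       2 * pi * (cmod (u 0))\<^sup>2 + \<rho>\<^sup>2 * I + 2 * 0) {0..2*pi}"
    by (intro has_integral_add has_integral_mult_right)
  also have "(\<lambda>t. (cmod (u 0))\<^sup>2 + \<rho>\<^sup>2 * (cmod (v (of_real \<rho> * cis t)))\<^sup>2 +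
       2 * Re (cnj (u 0) * ((of_real \<rho> * cis t) * v (of_real \<rho> * cis t)))) =
       (\<lambda>t. (cmod (u (of_real \<rho> * cis t)))\<^sup>2)"
  proof
    fix t
    have "(cmod (a + b))\<^sup>2 = (cmod a)\<^sup>2 + (cmod b)\<^sup>2 + 2 * Re (cnj a * b)" for a b
      unfolding cmod_power2 by (simp add: power2_eq_square algebra_simps)
    from this[of "u 0" "(of_real \<rho> * cis t) * v (of_real \<rho> * cis t)"]
    show "(cmod (u 0))\<^sup>2 + \<rho>\<^sup>2 * (cmod (v (of_real \<rho> * cis t)))\<^sup>2 +
       2 * Re (cnj (u 0) * ((of_real \<rho> * cis t) * v (of_real \<rho> * cis t))) = (cmod (u (of_real \<rho> * cis t)))\<^sup>2"
      unfolding u[of "of_real \<rho> * cis t", symmetric] by (simp add: norm_mult power_mult_distrib)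
  qed
  finally have "integral {0..2*pi} (\<lambda>t. (cmod (u (of_real \<rho> * cis t)))\<^sup>2) = 
       2 * pi * (cmod (u 0))\<^sup>2 + \<rho>\<^sup>2 * I"
    by (simp add: integral_unique)
  moreover have "2 * pi * (\<Sum>k<N. (cmod (fps_nth U (Suc k)))\<^sup>2 * \<rho> ^ (2 * k)) \<le> I"
    using Suc.IH[OF v vexp] by (simp add: I_def)
  hence "\<rho>\<^sup>2 * (2 * pi * (\<Sum>k<N. (cmod (fps_nth U (Suc k)))\<^sup>2 * \<rho> ^ (2 * k))) \<le> \<rho>\<^sup>2 * I"
    by (intro mult_left_mono) auto
  moreover have "(\<Sum>k<Suc N. (cmod (fps_nth U k))\<^sup>2 * \<rho> ^ (2 * k)) =
      (cmod (u 0))\<^sup>2 + \<rho>\<^sup>2 * (\<Sum>k<N. (cmod (fps_nth U (Suc k)))\<^sup>2 * \<rho> ^ (2 * k))"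
    unfolding sum.lessThan_Suc_shift sum_distrib_left
    by (intro arg_cong2[where f = "(+)"] sum.cong) (simp_all add: U0 power2_eq_square)
  ultimately show ?case
    by (simp only: distrib_left mult.left_commute add_left_mono)
qed (auto intro!: integral_nonneg integrable_continuous_real continuous_intros continuous_on_circle \<rho>)

section \<open>Areas of images of rectangles\<close>

text \<open>The change of variables formula is available on \<open>real ^ 2\<close>, iterated integrals on \<open>real \<times> real\<close>; the obvious
identification of the two preserves the content of intervals.\<close>

lemma has_integral_real2_prod:
  fixes F :: "real \<times> real \<Rightarrow> real"
  assumes "continuous_on (cbox (a, \<alpha>) (b, \<beta>)) F"
  shows "((\<lambda>u::real^2. F (u $ 1, u $ 2)) has_integral
           integral {a..b} (\<lambda>x. integral {\<alpha>..\<beta>} (\<lambda>y. F (x, y)))) (cbox (vector [a, \<alpha>]) (vector [b, \<beta>]))"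
proof -
  define g where "g = (\<lambda>u::real^2. (u $ 1, u $ 2))"
  define h where "h = (\<lambda>p::real\<times>real. vector [fst p, snd p] :: real^2)"
  have hg: "h (g u) = u" for u by (simp add: h_def g_def vec_eq_iff forall_2)
  have gh: "g (h p) = p" for p by (simp add: h_def g_def)
  have gcbox: "g ` cbox u v = cbox (g u) (g v)" for u v
  proof (intro equalityI subsetI)
    fix p assume "p \<in> cbox (g u) (g v)"
    hence "h p \<in> cbox u v" by (cases p) (auto simp: h_def g_def mem_box_cart forall_2)
    thus "p \<in> g ` cbox u v" by (metis gh image_eqI)
  qed (auto simp: g_def mem_box_cart forall_2)
  have hcbox: "h ` cbox p q = cbox (h p) (h q)" for p q
  proof -
    have "h ` cbox p q = h ` g ` cbox (h p) (h q)" using gcbox[of "h p" "h q"] by (simp add: gh)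
    thus ?thesis by (simp add: image_image hg)
  qed
  have content: "Henstock_Kurzweil_Integration.content (cbox u v) = Henstock_Kurzweil_Integration.content (cbox (g u) (g v))" for u v
  proof (cases "u $ 1 \<le> v $ 1 \<and> u $ 2 \<le> v $ 2")
    case True
    have ne: "cbox u v \<noteq> {}" using True by (auto simp: interval_ne_empty_cart forall_2)
    have "Henstock_Kurzweil_Integration.content (cbox u v) = (v$1 - u$1) * (v$2 - u$2)"
      using True by (subst content_cbox_cart) (auto simp: ne UNIV_2)
    also have "\<dots> = Henstock_Kurzweil_Integration.content (cbox (g u) (g v))"
      using True by (simp add: g_def content_Pair)
    finally show ?thesis .
  next
    case False
    hence "cbox u v = {}" by (auto simp: mem_box_cart forall_2)
    moreover hence "cbox (g u) (g v) = {}" using gcbox by (metis image_empty)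
    ultimately show ?thesis by simp
  qed
  have "(F has_integral integral (cbox (a, \<alpha>) (b, \<beta>)) F) (cbox (a, \<alpha>) (b, \<beta>))"
    using assms by (intro integrable_integral integrable_continuous)
  also have "integral (cbox (a, \<alpha>) (b, \<beta>)) F = integral {a..b} (\<lambda>x. integral {\<alpha>..\<beta>} (\<lambda>y. F (x, y)))"
    using integral_prod_continuous[OF assms] by simp
  finally have "((\<lambda>u. F (g u)) has_integral (1 / 1) *\<^sub>R
       integral {a..b} (\<lambda>x. integral {\<alpha>..\<beta>} (\<lambda>y. F (x, y)))) (h ` cbox (a, \<alpha>) (b, \<beta>))"
  proof (rule has_integral_twiddle[rotated -1])
    show "\<exists>w z. g ` cbox u v = cbox w z" for u v using gcbox by blast
    show "\<exists>w z. h ` cbox u v = cbox w z" for u v using hcbox by blast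
    show "continuous (at x) g" for x unfolding g_def by (intro continuous_intros)
    show "Henstock_Kurzweil_Integration.content (g ` cbox u v) = 1 * Henstock_Kurzweil_Integration.content (cbox u v)" for u v using content gcbox by simp
  qed (auto simp: hg gh)
  thus ?thesis by (simp add: hcbox) (simp add: h_def g_def)
qed

text \<open>The Jacobian of a map whose Wirtinger derivatives are \<open>p\<close> and \<open>q\<close>.\<close>

lemma det_complex_real_linear:
  fixes p q :: complex
  defines "A \<equiv> (\<lambda>h::real^2. vector [Re (p * Complex (h$1) (h$2) + q * cnj (Complex (h$1) (h$2))),
                                     Im (p * Complex (h$1) (h$2) + q * cnj (Complex (h$1) (h$2)))] :: real^2)"
  shows "det (matrix A) = (cmod p)\<^sup>2 - (cmod q)\<^sup>2"
proof -
  have A1: "A (axis 1 1) = vector [Re p + Re q, Im p + Im q]"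
    and A2: "A (axis 2 1) = vector [Im q - Im p, Re p - Re q]"
    by (simp_all add: A_def axis_def)
  have "det (matrix A) = (Re p + Re q) * (Re p - Re q) - (Im q - Im p) * (Im p + Im q)"
    unfolding det_2 by (simp add: matrix_def A1 A2)
  thus ?thesis unfolding cmod_power2 by (simp add: power2_eq_square algebra_simps)
qed

definition vec_of_complex :: "complex \<Rightarrow> real ^ 2" where
  "vec_of_complex z = vector [Re z, Im z]"

definition complex_of_vec :: "real ^ 2 \<Rightarrow> complex" where
  "complex_of_vec u = Complex (u $ 1) (u $ 2)"

lemma bounded_linear_vec_of_complex: "bounded_linear vec_of_complex"
  unfolding linear_conv_bounded_linear[symmetric]
  by (rule linearI) (simp_all add: vec_of_complex_def vec_eq_iff forall_2)

lemma bounded_linear_complex_of_vec: "bounded_linear complex_of_vec"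
  unfolding linear_conv_bounded_linear[symmetric]
  by (rule linearI) (simp_all add: complex_of_vec_def complex_eq_iff)

lemma norm_vec_of_complex: "norm (vec_of_complex z) = cmod z"
  by (simp add: vec_of_complex_def norm_vec_def L2_set_def sum_2 cmod_def)

lemma vec_of_complex_eq_iff: "vec_of_complex z = vec_of_complex w \<longleftrightarrow> z = w"
  by (simp add: vec_of_complex_def vec_eq_iff forall_2 complex_eq_iff)

text \<open>The map \<open>E - c cnj E\<close> is injective with Jacobian \<open>(1 - |c|\<^sup>2) |E'|\<^sup>2\<close>, so the left-hand side is the area of its image,
which lies in a disc of radius \<open>B\<close>.\<close>

lemma area_quasi_holomorphic_image:
  fixes E :: "complex \<Rightarrow> complex"
  assumes holo: "E holomorphic_on T" and T: "open T"
    and rect: "\<And>x y. a \<le> x \<Longrightarrow> x \<le> b \<Longrightarrow> \<alpha> \<le> y \<Longrightarrow> y \<le> \<beta> \<Longrightarrow> Complex x y \<in> T"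
    and inj: "inj_on E (box (Complex a \<alpha>) (Complex b \<beta>))"
    and c: "cmod c < 1"
    and bd: "\<And>w. w \<in> box (Complex a \<alpha>) (Complex b \<beta>) \<Longrightarrow> cmod (E w - c * cnj (E w) - ctr) \<le> B"
    and B: "0 \<le> B"
  shows "(1 - (cmod c)\<^sup>2) * integral {a..b} (\<lambda>x. integral {\<alpha>..\<beta>} (\<lambda>y. (cmod (deriv E (Complex x y)))\<^sup>2)) \<le> pi * B\<^sup>2"
proof -
  define S :: "(real ^ 2) set" where "S = box (vector [a, \<alpha>]) (vector [b, \<beta>])"
  define L where "L = (\<lambda>y. y - c * cnj y)"
  define g where "g = (\<lambda>u. vec_of_complex (L (E (complex_of_vec u))))"
  define D where "D = (\<lambda>u. deriv E (complex_of_vec u))"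
  define g' where "g' = (\<lambda>u h. vec_of_complex (L (D u * complex_of_vec h)))"
  have S_box: "complex_of_vec u \<in> box (Complex a \<alpha>) (Complex b \<beta>)" if "u \<in> S" for u
    using that by (auto simp: S_def complex_of_vec_def mem_box_cart forall_2 in_box_complex_iff)
  have S_T: "complex_of_vec u \<in> T" if "u \<in> S" for u
    using S_box[OF that] rect by (auto simp: complex_of_vec_def in_box_complex_iff)
  have L_lin: "bounded_linear L"
    unfolding L_def by (intro bounded_linear_intros bounded_linear_cnj)
  have L_inj: "y = y'" if "L y = L y'" for y y'
  proof (rule ccontr)
    assume "y \<noteq> y'"
    have "y - y' = c * cnj (y - y')" using that by (simp add: L_def algebra_simps)
    hence "cmod (y - y') = cmod c * cmod (y - y')" by (metis norm_mult complex_mod_cnj)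
    thus False using c \<open>y \<noteq> y'\<close> by simp
  qed
  have deriv: "(g has_derivative g' u) (at u within S)" if "u \<in> S" for u
  proof -
    have "(E has_derivative (\<lambda>h. D u * h)) (at (complex_of_vec u))"
      using holomorphic_derivI[OF holo T S_T[OF that]] by (simp add: D_def has_field_derivative_def)
    hence "((\<lambda>u. E (complex_of_vec u)) has_derivative (\<lambda>h. D u * complex_of_vec h)) (at u within S)"
      using bounded_linear.has_derivative[OF bounded_linear_complex_of_vec has_derivative_ident]
      by (rule has_derivative_compose[rotated])
    thus ?thesis unfolding g_def g'_def
      by (intro bounded_linear.has_derivative[OF bounded_linear_vec_of_complex]
            bounded_linear.has_derivative[OF L_lin])
  qed
  have inj_g: "inj_on g S"
  proof (rule inj_onI)
    fix u v assume uv: "u \<in> S" "v \<in> S" "g u = g v"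
    hence "L (E (complex_of_vec u)) = L (E (complex_of_vec v))"
      by (simp add: g_def vec_of_complex_eq_iff)
    hence "complex_of_vec u = complex_of_vec v"
      using L_inj inj_onD[OF inj] S_box uv by blast
    thus "u = v" by (simp add: complex_of_vec_def vec_eq_iff forall_2)
  qed
  have det: "\<bar>det (matrix (g' u))\<bar> = (1 - (cmod c)\<^sup>2) * (cmod (D u))\<^sup>2" for u
  proof -
    have "g' u = (\<lambda>h. vector [Re (D u * Complex (h$1) (h$2) + (- c * cnj (D u)) * cnj (Complex (h$1) (h$2))),
                     Im (D u * Complex (h$1) (h$2) + (- c * cnj (D u)) * cnj (Complex (h$1) (h$2)))])"
      by (simp add: g'_def vec_of_complex_def L_def complex_of_vec_def mult.assoc)
    hence "det (matrix (g' u)) = (1 - (cmod c)\<^sup>2) * (cmod (D u))\<^sup>2"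
      by (simp only: det_complex_real_linear) (simp add: norm_mult power_mult_distrib algebra_simps)
    moreover have "(cmod c)\<^sup>2 \<le> 1" using c by (simp add: power_le_one)
    ultimately show ?thesis by simp
  qed
  define J where "J = integral {a..b} (\<lambda>x. integral {\<alpha>..\<beta>} (\<lambda>y. (cmod (deriv E (Complex x y)))\<^sup>2))"
  have contD: "continuous_on T (deriv E)"
    using holomorphic_deriv[OF holo T] by (rule holomorphic_on_imp_continuous_on)
  have "continuous_on (cbox (a, \<alpha>) (b, \<beta>)) (\<lambda>p. (cmod (deriv E (Complex (fst p) (snd p))))\<^sup>2)"
    by (intro continuous_intros continuous_on_compose2[OF contD]) (auto simp: rect)
  from has_integral_real2_prod[OF this]
  have "((\<lambda>u. (cmod (D u))\<^sup>2) has_integral J) (cbox (vector [a, \<alpha>]) (vector [b, \<beta>]))"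
    by (simp add: J_def D_def complex_of_vec_def)
  hence "((\<lambda>u. (1 - (cmod c)\<^sup>2) * (cmod (D u))\<^sup>2) has_integral (1 - (cmod c)\<^sup>2) * J) S"
    unfolding S_def has_integral_open_interval by (rule has_integral_mult_right)
  hence "((\<lambda>u. \<bar>det (matrix (g' u))\<bar>) has_integral (1 - (cmod c)\<^sup>2) * J) S" by (simp only: det)
  moreover have "S \<in> sets lebesgue" by (simp add: S_def)
  ultimately have area: "g ` S \<in> lmeasurable" "measure lebesgue (g ` S) = (1 - (cmod c)\<^sup>2) * J"
    using has_measure_differentiable_image[OF _ deriv inj_g] by blast+
  have "g ` S \<subseteq> cball (vec_of_complex ctr) B"
  proof
    fix v assume "v \<in> g ` S"
    then obtain u where u: "u \<in> S" "v = g u" by blast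
    have "v - vec_of_complex ctr = vec_of_complex (L (E (complex_of_vec u)) - ctr)"
      unfolding u g_def by (simp add: linear_diff bounded_linear.linear[OF bounded_linear_vec_of_complex])
    hence "norm (v - vec_of_complex ctr) \<le> B"
      using bd[OF S_box[OF u(1)]] by (simp add: norm_vec_of_complex L_def)
    thus "v \<in> cball (vec_of_complex ctr) B" by (simp add: dist_norm norm_minus_commute)
  qed
  hence "measure lebesgue (g ` S) \<le> measure lebesgue (cball (vec_of_complex ctr) B)"
    using area(1) by (intro measure_mono_fmeasurable) auto
  also have "\<dots> = pi * B\<^sup>2"
    using B by (simp add: content_cball unit_ball_vol_2)
  finally show ?thesis using area(2) by (simp add: J_def)
qed

section \<open>The area theorem\<close>

lemma taylor_remainder_at_0:
  assumes "u holomorphic_on ball 0 1" "u has_fps_expansion U"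
  shows "\<exists>h. h holomorphic_on ball 0 1 \<and> (\<forall>z. u z = (\<Sum>k<n. fps_nth U k * z ^ k) + z ^ n * h z)"
  using assms
proof (induction n arbitrary: u U)
  case 0
  thus ?case by auto
next
  case (Suc n)
  obtain v where v: "v holomorphic_on ball 0 1" "v has_fps_expansion fps_shift 1 U"
    "\<And>z. u z = u 0 + z * v z"
    using divided_difference_at_0[OF Suc.prems] by blast
  obtain h where h: "h holomorphic_on ball 0 1"
      "\<And>z. v z = (\<Sum>k<n. fps_nth U (Suc k) * z ^ k) + z ^ n * h z"
    using Suc.IH[OF v(1,2)] by auto
  have U0: "u 0 = fps_nth U 0"
    using Suc.prems(2) by (rule has_fps_expansion_imp_0_eq_fps_nth_0)
  have "u z = (\<Sum>k<Suc n. fps_nth U k * z ^ k) + z ^ Suc n * h z" for z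
  proof -
    have "u z = fps_nth U 0 + z * ((\<Sum>k<n. fps_nth U (Suc k) * z ^ k) + z ^ n * h z)"
      using v(3)[of z] h(2)[of z] U0 by metis
    thus ?thesis unfolding sum.lessThan_Suc_shift
      by (simp add: sum_distrib_left algebra_simps)
  qed
  with h(1) show ?case by blast
qed

text \<open>The Taylor series of \<open>z / f(z)\<close> at 0.\<close>

definition reciprocal_fps :: "(complex \<Rightarrow> complex) \<Rightarrow> complex fps" where
  "reciprocal_fps f = inverse (fps_shift 1 (fps_expansion f 0))"

lemma class_S_fps_expansion:
  assumes "f \<in> class_S"
  shows "f has_fps_expansion fps_expansion f 0" "fps_nth (fps_expansion f 0) 0 = 0"
    "fps_nth (fps_expansion f 0) 1 = 1"
proof -
  show "f has_fps_expansion fps_expansion f 0"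
    using holomorphic_on_imp_analytic_at[OF class_S_D(1)[OF assms], of 0]
    by (intro analytic_at_imp_has_fps_expansion_0) simp
qed (use class_S_D[OF assms] in \<open>simp_all add: fps_expansion_def\<close>)

lemma class_S_reciprocal:
  assumes f: "f \<in> class_S"
  obtains g where "g holomorphic_on ball 0 1" "g has_fps_expansion reciprocal_fps f"
    "g 0 = 1" "\<And>z. cmod z < 1 \<Longrightarrow> g z * f z = z" "\<And>z. cmod z < 1 \<Longrightarrow> g z \<noteq> 0"
proof -
  note D = class_S_D[OF f] and E = class_S_fps_expansion[OF f]
  obtain q where q: "q holomorphic_on ball 0 1" "q has_fps_expansion fps_shift 1 (fps_expansion f 0)"
    "\<And>z. f z = z * q z"
    using divided_difference_at_0[OF D(1) E(1)] unfolding D(2) add_0 by blast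
  have q0: "q 0 = 1"
    using has_fps_expansion_imp_0_eq_fps_nth_0[OF q(2)] E(3) by simp
  have qnz: "q z \<noteq> 0" if "cmod z < 1" for z
  proof (cases "z = 0")
    case False
    hence "f z \<noteq> 0" using inj_onD[OF D(4), of z 0] D(2) that by auto
    thus ?thesis by (subst (asm) q(3)) simp
  qed (simp add: q0)
  show ?thesis
  proof (rule that[of "\<lambda>z. inverse (q z)"])
    show "(\<lambda>z. inverse (q z)) holomorphic_on ball 0 1"
      using qnz by (intro holomorphic_intros q(1)) auto
    show "(\<lambda>z. inverse (q z)) has_fps_expansion reciprocal_fps f"
      unfolding reciprocal_fps_def using E(3) by (intro fps_expansion_intros q(2)) auto
    show "inverse (q z) * f z = z" if "cmod z < 1" for z
      using qnz[OF that] by (subst q(3)) simp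
  qed (use q0 qnz in auto)
qed

text \<open>The right-hand side is the area of the image of the annulus \<open>r < |z| < \<rho>\<close> under \<open>g(z)/z\<close>, in the coordinates
\<open>z = exp w\<close>, in which the annulus becomes a rectangle.  The derivative in \<open>w\<close> is \<open>u(z)/z\<close> with
\<open>u = z g' - g\<close>, and the Bessel inequality on each circle is integrated over the radius.\<close>

lemma area_annulus_lower_bound:
  assumes g: "g holomorphic_on ball 0 1" "g has_fps_expansion G" and G0: "fps_nth G 0 = 1"
    and r: "0 < r" "r < \<rho>" "\<rho> < 1"
  defines "E \<equiv> (\<lambda>w. g (exp w) / exp w)"
  shows "pi * (1 / r\<^sup>2 - 1 / \<rho>\<^sup>2 + (\<Sum>j=1..N. real j * (cmod (fps_nth G (Suc j)))\<^sup>2 * (\<rho> ^ (2*j) - r ^ (2*j))))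
     \<le> integral {ln r..ln \<rho>} (\<lambda>x. integral {0..2*pi} (\<lambda>y. (cmod (deriv E (Complex x y)))\<^sup>2))"
proof -
  define u where "u = (\<lambda>z. z * deriv g z - g z)"
  \<comment> \<open>\<open>U\<^sub>k = (k - 1) G\<^sub>k\<close>: the coefficient \<open>G\<^sub>1\<close>, a translation of the image, has no effect on areas.\<close>
  define U where "U = fps_X * fps_deriv G - G"
  have u: "u holomorphic_on ball 0 1"
    unfolding u_def by (intro holomorphic_intros holomorphic_deriv g) auto
  have U: "u has_fps_expansion U"
    unfolding u_def U_def by (intro fps_expansion_intros g)
  have U_nth: "fps_nth U k = (of_nat k - 1) * fps_nth G k" for k
    by (cases k) (simp_all add: U_def algebra_simps)
  have dE: "deriv E (Complex x y) = u (of_real (exp x) * cis y) / (of_real (exp x) * cis y)" if "x < 0" for x y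
  proof -
    have ew: "exp (Complex x y) = of_real (exp x) * cis y"
      by (simp add: exp_eq_polar)
    have "(g has_field_derivative deriv g (exp (Complex x y))) (at (exp (Complex x y)))"
      using that by (intro holomorphic_derivI[OF g(1)]) auto
    from DERIV_chain2[where g = exp, OF this DERIV_exp]
    have [derivative_intros]: "((\<lambda>w. g (exp w)) has_field_derivative 
        deriv g (exp (Complex x y)) * exp (Complex x y)) (at (Complex x y))" .
    have "(E has_field_derivative (deriv g (exp (Complex x y)) * exp (Complex x y) * exp (Complex x y) 
            - g (exp (Complex x y)) * exp (Complex x y)) / (exp (Complex x y) * exp (Complex x y))) (at (Complex x y))"
      unfolding E_def by (auto intro!: derivative_eq_intros)
    also have "(deriv g (exp (Complex x y)) * exp (Complex x y) * exp (Complex x y) 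
            - g (exp (Complex x y)) * exp (Complex x y)) / (exp (Complex x y) * exp (Complex x y)) =
          u (exp (Complex x y)) / exp (Complex x y)"
      by (simp add: u_def divide_simps) (simp add: algebra_simps)
    finally have "deriv E (Complex x y) = u (exp (Complex x y)) / exp (Complex x y)"
      by (rule DERIV_imp_deriv)
    thus ?thesis unfolding ew .
  qed
  have inner: "2 * pi * (1 / (exp x)\<^sup>2 + (\<Sum>j=1..N. (real j)\<^sup>2 * (cmod (fps_nth G (Suc j)))\<^sup>2 * exp x ^ (2*j)))
       \<le> integral {0..2*pi} (\<lambda>y. (cmod (deriv E (Complex x y)))\<^sup>2)" if "x < 0" for x
  proof -
    have sum_eq: "(\<Sum>k<N+2. (cmod (fps_nth U k))\<^sup>2 * exp x ^ (2 * k)) =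
        1 + (\<Sum>j=1..N. (real j)\<^sup>2 * (cmod (fps_nth G (Suc j)))\<^sup>2 * exp x ^ (2*j)) * (exp x)\<^sup>2"
    proof -
      have "(\<Sum>k<N+2. (cmod (fps_nth U k))\<^sup>2 * exp x ^ (2 * k)) = 
              1 + (\<Sum>k<N. (cmod (fps_nth U (Suc (Suc k))))\<^sup>2 * exp x ^ (2 * Suc (Suc k)))"
        by (simp add: sum.lessThan_Suc_shift U_nth G0 del: sum.lessThan_Suc)
      also have "(\<Sum>k<N. (cmod (fps_nth U (Suc (Suc k))))\<^sup>2 * exp x ^ (2 * Suc (Suc k))) = 
          (\<Sum>j=1..N. (cmod (fps_nth U (Suc j)))\<^sup>2 * exp x ^ (2 * Suc j))"
        by (rule sum.reindex_bij_witness[of _ "\<lambda>j. j - 1" Suc]) auto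
      also have "\<dots> = (\<Sum>j=1..N. (real j)\<^sup>2 * (cmod (fps_nth G (Suc j)))\<^sup>2 * exp x ^ (2*j)) * (exp x)\<^sup>2"
        unfolding sum_distrib_right
        by (intro sum.cong) (simp_all add: U_nth norm_mult power_mult_distrib power2_eq_square)
      finally show ?thesis .
    qed
    have "2 * pi * (1 / (exp x)\<^sup>2 + (\<Sum>j=1..N. (real j)\<^sup>2 * (cmod (fps_nth G (Suc j)))\<^sup>2 * exp x ^ (2*j)))
        = 2 * pi * (\<Sum>k<N+2. (cmod (fps_nth U k))\<^sup>2 * exp x ^ (2 * k)) / (exp x)\<^sup>2"
      unfolding sum_eq by (simp add: add_divide_distrib distrib_left)
    also have "\<dots> \<le> integral {0..2*pi} (\<lambda>t. (cmod (u (of_real (exp x) * cis t)))\<^sup>2) / (exp x)\<^sup>2"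
      using circle_Bessel[OF u _ _ U, of "exp x" "N+2"] that by (intro divide_right_mono) auto
    also have "\<dots> = integral {0..2*pi} (\<lambda>y. (cmod (deriv E (Complex x y)))\<^sup>2)"
      by (simp add: dE[OF that] norm_divide norm_mult power_divide)
    finally show ?thesis .
  qed
  have ln_neg: "x < 0" if "x \<le> ln \<rho>" for x
  proof -
    have "ln \<rho> < 0" using r by simp
    with that show ?thesis by linarith
  qed
  define \<Phi> where "\<Phi> = (\<lambda>x. pi * (- (1 / (exp x)\<^sup>2) + (\<Sum>j=1..N. real j * (cmod (fps_nth G (Suc j)))\<^sup>2 * exp x ^ (2*j))))"
  have "((\<lambda>x. 2 * pi * (1 / (exp x)\<^sup>2 + (\<Sum>j=1..N. (real j)\<^sup>2 * (cmod (fps_nth G (Suc j)))\<^sup>2 * exp x ^ (2*j))))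
      has_integral \<Phi> (ln \<rho>) - \<Phi> (ln r)) {ln r..ln \<rho>}"
  proof (rule fundamental_theorem_of_calculus)
    fix x
    have pow: "((\<lambda>x. exp x ^ (2*j)) has_real_derivative 2 * real j * exp x ^ (2*j)) (at x)" for j
      unfolding exp_of_nat_mult[symmetric] by (auto intro!: derivative_eq_intros)
    have inv: "((\<lambda>x. 1 / (exp x)\<^sup>2) has_real_derivative - 2 / (exp x)\<^sup>2) (at x)"
      by (auto intro!: derivative_eq_intros simp: power2_eq_square)
    have "(\<Phi> has_real_derivative pi * (- (- 2 / (exp x)\<^sup>2) + 
        (\<Sum>j=1..N. real j * (cmod (fps_nth G (Suc j)))\<^sup>2 * (2 * real j * exp x ^ (2*j))))) (at x)"
      unfolding \<Phi>_def by (intro DERIV_cmult DERIV_add DERIV_minus inv DERIV_sum pow)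
    also have "pi * (- (- 2 / (exp x)\<^sup>2) + 
        (\<Sum>j=1..N. real j * (cmod (fps_nth G (Suc j)))\<^sup>2 * (2 * real j * exp x ^ (2*j)))) =
        2 * pi * (1 / (exp x)\<^sup>2 + (\<Sum>j=1..N. (real j)\<^sup>2 * (cmod (fps_nth G (Suc j)))\<^sup>2 * exp x ^ (2*j)))"
      by (simp add: algebra_simps sum_distrib_left power2_eq_square)
    finally show "(\<Phi> has_vector_derivative 2 * pi * (1 / (exp x)\<^sup>2 + 
        (\<Sum>j=1..N. (real j)\<^sup>2 * (cmod (fps_nth G (Suc j)))\<^sup>2 * exp x ^ (2*j)))) (at x within {ln r..ln \<rho>})"
      by (simp add: has_real_derivative_iff_has_vector_derivative has_vector_derivative_at_within)
  qed (use r in auto)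
  moreover have "(\<lambda>x. integral {0..2*pi} (\<lambda>y. (cmod (deriv E (Complex x y)))\<^sup>2)) integrable_on {ln r..ln \<rho>}"
  proof -
    have "continuous_on (cbox (ln r, 0) (ln \<rho>, 2*pi)) (\<lambda>p. (cmod (u (of_real (exp (fst p)) * cis (snd p)) / (of_real (exp (fst p)) * cis (snd p))))\<^sup>2)"
      using r by (intro continuous_intros continuous_on_compose2[OF holomorphic_on_imp_continuous_on[OF u]])
         (auto simp: norm_mult ln_neg)
    from integral_integrable_2dim[OF this]
    have "(\<lambda>x. integral {0..2*pi} (\<lambda>y. (cmod (u (of_real (exp x) * cis y) / (of_real (exp x) * cis y)))\<^sup>2)) integrable_on {ln r..ln \<rho>}"
      by simp
    thus ?thesis
      by (rule integrable_eq) (auto simp: dE ln_neg)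
  qed
  ultimately have "\<Phi> (ln \<rho>) - \<Phi> (ln r) \<le> integral {ln r..ln \<rho>} (\<lambda>x. integral {0..2*pi} (\<lambda>y. (cmod (deriv E (Complex x y)))\<^sup>2))"
    by (elim has_integral_le[OF _ integrable_integral]) (use inner ln_neg in auto)
  moreover have "\<Phi> (ln \<rho>) - \<Phi> (ln r) = pi * (1 / r\<^sup>2 - 1 / \<rho>\<^sup>2 + 
       (\<Sum>j=1..N. real j * (cmod (fps_nth G (Suc j)))\<^sup>2 * (\<rho> ^ (2*j) - r ^ (2*j))))"
    using r by (simp add: \<Phi>_def algebra_simps sum_subtractf)
  ultimately show ?thesis by simp
qed

text \<open>Near 0, \<open>1/f(z) = 1/z + b\<^sub>0 + b\<^sub>1 z + O(z\<^sup>2)\<close>.  On \<open>|z| = r\<close> the part \<open>1/z + b\<^sub>1 z\<close> runs through an ellipse, and the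
real-linear map \<open>y \<mapsto> y - c cnj y\<close> with \<open>c = b\<^sub>1 r\<^sup>2\<close> sends it to a circle of radius
\<open>(1 - |c|\<^sup>2)/r\<close>, because \<open>cnj z = r\<^sup>2/z\<close>.  The image of \<open>r < |z| < 1\<close> under \<open>1/f\<close> is in the convex hull of the
image of the circle, so it obeys the same bound.  A disc of radius \<open>1/r + |b\<^sub>1| r + O(r\<^sup>2)\<close> around \<open>b\<^sub>0\<close>
would be too large: its area exceeds that of the ellipse by an amount that does not tend to 0 with \<open>r\<close>.\<close>

lemma annulus_image_bound:
  assumes f: "f \<in> class_S" and g: "g holomorphic_on ball 0 1" "g has_fps_expansion G" "g 0 = 1"
    "\<And>z. cmod z < 1 \<Longrightarrow> g z * f z = z"
  obtains M where "0 \<le> M"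
    "\<And>r z. 0 < r \<Longrightarrow> r \<le> 1/2 \<Longrightarrow> cmod (fps_nth G 2) * r\<^sup>2 < 1 \<Longrightarrow> r < cmod z \<Longrightarrow> cmod z < 1 \<Longrightarrow>
       cmod ((1 / f z - fps_nth G 1) - fps_nth G 2 * of_real (r\<^sup>2) * cnj (1 / f z - fps_nth G 1))
         \<le> (1 - (cmod (fps_nth G 2) * r\<^sup>2)\<^sup>2) / r + 2 * M * r\<^sup>2"
proof -
  note D = class_S_D[OF f]
  define b0 b1 where "b0 = fps_nth G 1" and "b1 = fps_nth G 2"
  have G0: "fps_nth G 0 = 1"
    using has_fps_expansion_imp_0_eq_fps_nth_0[OF g(2)] g(3) by simp
  obtain h where h: "h holomorphic_on ball 0 1" "\<And>z. g z = (\<Sum>k<3. fps_nth G k * z ^ k) + z ^ 3 * h z"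
    using taylor_remainder_at_0[OF g(1,2), of 3] by blast
  have "continuous_on (cball 0 (1/2)) h"
    using h(1) by (intro holomorphic_on_imp_continuous_on holomorphic_on_subset[OF h(1)]) auto
  hence "compact (h ` cball 0 (1/2))" by (intro compact_continuous_image) auto
  then obtain M where M: "\<And>z. cmod z \<le> 1/2 \<Longrightarrow> cmod (h z) \<le> M"
    by (meson bounded_iff compact_imp_bounded image_eqI mem_cball_0)
  have M0: "0 \<le> M" by (rule order_trans[OF norm_ge_zero M[of 0]]) simp
  have recip: "1 / f z = 1 / z + b0 + b1 * z + z\<^sup>2 * h z" if "cmod z < 1" "z \<noteq> 0" for z
  proof -
    have "f z \<noteq> 0" using g(4)[OF that(1)] that(2) by auto
    hence "1 / f z = g z / z" using g(4)[OF that(1)] that(2) by (simp add: field_simps)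
    also have "g z = 1 + b0 * z + b1 * z\<^sup>2 + z ^ 3 * h z"
      by (subst h(2)) (simp add: numeral_3_eq_3 G0 b0_def b1_def power2_eq_square numeral_2_eq_2)
    also have "\<dots> / z = 1 / z + b0 + b1 * z + z\<^sup>2 * h z"
      using that(2) by (simp add: field_simps power2_eq_square power3_eq_cube)
    finally show ?thesis .
  qed
  show ?thesis
  proof (rule that[OF M0])
    fix r :: real and w :: complex
    assume r: "0 < r" "r \<le> 1/2" "cmod (fps_nth G 2) * r\<^sup>2 < 1" and w: "r < cmod w" "cmod w < 1"
    define c where "c = b1 * of_real (r\<^sup>2)"
    have nc: "cmod c = cmod b1 * r\<^sup>2" by (simp add: c_def norm_mult norm_power)
    hence c1: "cmod c < 1" using r(3) by (simp add: b1_def)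
    define L where "L = (\<lambda>y. y - c * cnj y)"
    define B where "B = (1 - (cmod c)\<^sup>2) / r + 2 * M * r\<^sup>2"
    have circle: "cmod (L (1 / f z - b0)) \<le> B" if z: "cmod z = r" for z
    proof -
      have "z \<noteq> 0" using z r by auto
      have zz: "cnj z = of_real (r\<^sup>2) / z"
        using \<open>z \<noteq> 0\<close> z complex_norm_square[of z] by (simp add: field_simps)
      have inv: "cnj (1 / z) = z / of_real (r\<^sup>2)"
        using zz \<open>z \<noteq> 0\<close> r by (simp add: field_simps)
      have "L (1 / f z - b0) = L (1 / z + b1 * z) + L (z\<^sup>2 * h z)"
        using recip[of z] z r \<open>z \<noteq> 0\<close> by (simp add: L_def algebra_simps)
      also have "L (1 / z + b1 * z) = (1 - c * cnj c) / z"
      proof -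
        have "c * cnj (1 / z + b1 * z) = c * cnj (1 / z) + c * cnj b1 * cnj z"
          by (simp add: algebra_simps)
        also have "\<dots> = b1 * z + c * cnj c / z"
          unfolding inv zz using r by (simp add: c_def field_simps)
        finally show ?thesis by (simp add: L_def diff_divide_distrib)
      qed
      finally have "cmod (L (1 / f z - b0)) \<le> cmod ((1 - c * cnj c) / z) + cmod (L (z\<^sup>2 * h z))"
        by (simp add: norm_triangle_ineq)
      moreover have "1 - c * cnj c = of_real (1 - (cmod c)\<^sup>2)"
        by (simp only: of_real_diff of_real_1 complex_norm_square)
      hence "cmod ((1 - c * cnj c) / z) = \<bar>1 - (cmod c)\<^sup>2\<bar> / r"
        by (simp only: norm_divide norm_of_real z)
      moreover have "(cmod c)\<^sup>2 \<le> 1" using c1 by (simp add: power_le_one)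
      moreover have "cmod (L (z\<^sup>2 * h z)) \<le> cmod (z\<^sup>2 * h z) + cmod c * cmod (z\<^sup>2 * h z)"
        unfolding L_def by (rule order_trans[OF norm_triangle_ineq4]) (simp add: norm_mult norm_power)
      moreover have "cmod c * cmod (z\<^sup>2 * h z) \<le> 1 * cmod (z\<^sup>2 * h z)"
        using c1 by (intro mult_right_mono) auto
      moreover have "cmod (z\<^sup>2 * h z) \<le> r\<^sup>2 * M"
        using M[of z] z r by (simp add: norm_mult norm_power mult_left_mono)
      moreover have "B = (1 - (cmod c)\<^sup>2) / r + 2 * (r\<^sup>2 * M)" by (simp add: B_def)
      ultimately show ?thesis by simp
    qed
    define v where "v = L (1 / f w - b0)"
    \<comment> \<open>The real-linear functional \<open>y \<mapsto> Re (cnj v \<sqdot> L y)\<close> has the form \<open>y \<mapsto> Re (k y)\<close>.\<close>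
    define k where "k = cnj v - v * cnj c"
    have inner: "Re (k * y) = Re (cnj v * L y)" for y
      by (simp add: k_def L_def algebra_simps)
    have "Re (k / f w) \<le> cmod v * B + Re (k * b0)"
    proof (rule reciprocal_in_half_plane[OF D(1,2,4) r(1) w])
      fix z :: complex assume z: "cmod z = r"
      have "Re (k / f z) = Re (k * (1 / f z - b0)) + Re (k * b0)" by (simp add: algebra_simps)
      also have "Re (k * (1 / f z - b0)) \<le> cmod (cnj v * L (1 / f z - b0))"
        unfolding inner by (rule complex_Re_le_cmod)
      also have "\<dots> \<le> cmod v * B"
        using circle[OF z] by (simp add: norm_mult mult_left_mono)
      finally show "Re (k / f z) \<le> cmod v * B + Re (k * b0)" by simp
    qed
    moreover have "Re (k / f w) - Re (k * b0) = Re (k * (1 / f w - b0))" by (simp add: algebra_simps)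
    ultimately have "Re (cnj v * v) \<le> cmod v * B" unfolding inner v_def[symmetric] by simp
    hence "cmod v * cmod v \<le> cmod v * B"
      by (simp add: cmod_power2 flip: power2_eq_square)
    moreover have "0 \<le> B" using M0 r c1 by (simp add: B_def power_le_one)
    ultimately have "cmod v \<le> B" by (cases "v = 0") auto
    thus "cmod ((1 / f w - fps_nth G 1) - fps_nth G 2 * of_real (r\<^sup>2) * cnj (1 / f w - fps_nth G 1))
         \<le> (1 - (cmod (fps_nth G 2) * r\<^sup>2)\<^sup>2) / r + 2 * M * r\<^sup>2"
      unfolding B_def nc unfolding v_def L_def c_def b0_def b1_def .
  qed
qed

text \<open>Gronwall's area theorem.  Comparing the two estimates for the area of the image of \<open>r < |z| < \<rho>\<close>, the terms
\<open>1/r\<^sup>2\<close> cancel.  The claim follows as first \<open>r\<close> tends to 0 and then \<open>\<rho>\<close> tends to 1.\<close>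

theorem area_theorem:
  assumes f: "f \<in> class_S"
  shows "(\<Sum>n=1..N. real n * (cmod (fps_nth (reciprocal_fps f) (Suc n)))\<^sup>2) \<le> 1"
proof -
  note D = class_S_D[OF f]
  define G where "G = reciprocal_fps f"
  obtain g where g: "g holomorphic_on ball 0 1" "g has_fps_expansion G"
    "g 0 = 1" "\<And>z. cmod z < 1 \<Longrightarrow> g z * f z = z"
    using class_S_reciprocal[OF f] unfolding G_def by metis
  have G0: "fps_nth G 0 = 1"
    using has_fps_expansion_imp_0_eq_fps_nth_0[OF g(2)] g(3) by simp
  have fnz: "f z \<noteq> 0" if "cmod z < 1" "z \<noteq> 0" for z using g(4)[OF that(1)] that(2) by auto
  obtain M where M: "0 \<le> M"
    "\<And>r z. 0 < r \<Longrightarrow> r \<le> 1/2 \<Longrightarrow> cmod (fps_nth G 2) * r\<^sup>2 < 1 \<Longrightarrow> r < cmod z \<Longrightarrow> cmod z < 1 \<Longrightarrow>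
       cmod ((1 / f z - fps_nth G 1) - fps_nth G 2 * of_real (r\<^sup>2) * cnj (1 / f z - fps_nth G 1))
         \<le> (1 - (cmod (fps_nth G 2) * r\<^sup>2)\<^sup>2) / r + 2 * M * r\<^sup>2"
    using annulus_image_bound[OF f g] by blast
  define \<beta> where "\<beta> = cmod (fps_nth G 2)"
  define e where "e = (\<lambda>j. real j * (cmod (fps_nth G (Suc j)))\<^sup>2)"
  define E where "E = (\<lambda>w. g (exp w) / exp w)"
  have E_eq: "E w = 1 / f (exp w)" if "Re w < 0" for w
    using g(4)[of "exp w"] fnz[of "exp w"] that by (simp add: E_def field_simps)
  have E_holo: "E holomorphic_on {w. Re w < 0}"
    unfolding E_def by (intro holomorphic_intros holomorphic_on_compose_gen[OF _ g(1), unfolded o_def]) auto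
  have annulus: "(\<Sum>j=1..N. e j * (\<rho> ^ (2*j) - r ^ (2*j))) \<le> 1 / \<rho>\<^sup>2 + 4 * M * r + 4 * M\<^sup>2 * r ^ 4 / (1 - (\<beta> * r\<^sup>2)\<^sup>2)"
    if r: "0 < r" "r \<le> 1/2" "\<beta> * r\<^sup>2 < 1" "r < \<rho>" "\<rho> < 1" for r \<rho>
  proof -
    define c where "c = fps_nth G 2 * of_real (r\<^sup>2)"
    have nc: "cmod c = \<beta> * r\<^sup>2" by (simp add: c_def \<beta>_def norm_mult norm_power)
    define d where "d = 1 - (\<beta> * r\<^sup>2)\<^sup>2"
    have d: "0 < d" "d \<le> 1" using r(3) r(1) 
      by (auto simp: d_def \<beta>_def power_less_one_iff abs_square_less_1)
    have re: "Re w < 0 \<and> r < cmod (exp w) \<and> cmod (exp w) < 1" 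
      if "w \<in> box (Complex (ln r) 0) (Complex (ln \<rho>) (2*pi))" for w
    proof -
      have 1: "ln r < Re w" "Re w < ln \<rho>" using that by (auto simp: in_box_complex_iff)
      hence "r < exp (Re w)" using r by (metis exp_less_cancel_iff exp_ln)
      moreover have "ln \<rho> < 0" using r by simp
      ultimately show ?thesis using 1 by simp
    qed
    have "d * (pi * (1 / r\<^sup>2 - 1 / \<rho>\<^sup>2 + (\<Sum>j=1..N. real j * (cmod (fps_nth G (Suc j)))\<^sup>2 * (\<rho> ^ (2*j) - r ^ (2*j)))))
       \<le> d * integral {ln r..ln \<rho>} (\<lambda>x. integral {0..2*pi} (\<lambda>y. (cmod (deriv E (Complex x y)))\<^sup>2))"
      unfolding E_def using d(1) by (intro mult_left_mono area_annulus_lower_bound g(1,2) G0 r) auto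
    also have "\<dots> \<le> pi * (d / r + 2 * M * r\<^sup>2)\<^sup>2"
      unfolding d_def nc[symmetric]
    proof (rule area_quasi_holomorphic_image[where ctr = "fps_nth G 1 - c * cnj (fps_nth G 1)"])
      show "E holomorphic_on {w. Re w < 0}" by (rule E_holo)
      show "open {w. Re w < 0}" by (rule open_halfspace_Re_lt)
      show "Complex x y \<in> {w. Re w < 0}" if "x \<le> ln \<rho>" for x y
      proof -
        have "ln \<rho> < 0" using r by simp
        with that show ?thesis by simp
      qed
      show "inj_on E (box (Complex (ln r) 0) (Complex (ln \<rho>) (2 * pi)))"
      proof (rule inj_onI)
        fix w w' assume w: "w \<in> box (Complex (ln r) 0) (Complex (ln \<rho>) (2*pi))"
            "w' \<in> box (Complex (ln r) 0) (Complex (ln \<rho>) (2*pi))" and "E w = E w'"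
        hence "f (exp w) = f (exp w')" using E_eq re by simp
        hence "exp w = exp w'" using inj_onD[OF D(4)] re w by auto
        moreover have "\<bar>Im w - Im w'\<bar> < 2 * pi" using w by (auto simp: in_box_complex_iff)
        ultimately show "w = w'" using exp_complex_eqI by blast
      qed
      show "cmod c < 1" using r(3) nc by simp
      show "cmod (E w - c * cnj (E w) - (fps_nth G 1 - c * cnj (fps_nth G 1))) \<le> (1 - (cmod c)\<^sup>2) / r + 2 * M * r\<^sup>2"
        if "w \<in> box (Complex (ln r) 0) (Complex (ln \<rho>) (2*pi))" for w
      proof -
        have "cmod ((1 / f (exp w) - fps_nth G 1) - c * cnj (1 / f (exp w) - fps_nth G 1))
            \<le> (1 - (cmod c)\<^sup>2) / r + 2 * M * r\<^sup>2"
          using M(2)[of r "exp w"] r re[OF that] unfolding c_def[symmetric] nc \<beta>_def by blast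
        thus ?thesis using E_eq re[OF that] by (simp add: algebra_simps)
      qed
      show "0 \<le> (1 - (cmod c)\<^sup>2) / r + 2 * M * r\<^sup>2" using M(1) r d unfolding nc d_def by simp
    qed
    finally have "pi * (d * (1 / r\<^sup>2 - 1 / \<rho>\<^sup>2 + (\<Sum>j=1..N. e j * (\<rho> ^ (2*j) - r ^ (2*j)))))
        \<le> pi * (d / r + 2 * M * r\<^sup>2)\<^sup>2" by (simp add: e_def mult_ac)
    hence "d * (1 / r\<^sup>2 - 1 / \<rho>\<^sup>2 + (\<Sum>j=1..N. e j * (\<rho> ^ (2*j) - r ^ (2*j)))) \<le> (d / r + 2 * M * r\<^sup>2)\<^sup>2"
      by (rule mult_left_le_imp_le) simp
    also have "\<dots> = d * (d / r\<^sup>2 + 4 * M * r + 4 * M\<^sup>2 * r ^ 4 / d)"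
      using d r by (simp add: field_simps power2_eq_square power4_eq_xxxx)
    finally have "1 / r\<^sup>2 - 1 / \<rho>\<^sup>2 + (\<Sum>j=1..N. e j * (\<rho> ^ (2*j) - r ^ (2*j))) \<le> d / r\<^sup>2 + 4 * M * r + 4 * M\<^sup>2 * r ^ 4 / d"
      using d by (simp only: mult_le_cancel_left_pos)
    moreover have "d / r\<^sup>2 \<le> 1 / r\<^sup>2" using d by (intro divide_right_mono) auto
    ultimately show ?thesis unfolding d_def by linarith
  qed
  have disc: "(\<Sum>j=1..N. e j * \<rho> ^ (2*j)) \<le> 1 / \<rho>\<^sup>2" if \<rho>: "0 < \<rho>" "\<rho> < 1" for \<rho>
  proof (rule tendsto_le[OF trivial_limit_at_right_real])
    show "((\<lambda>r. 1 / \<rho>\<^sup>2 + 4 * M * r + 4 * M\<^sup>2 * r ^ 4 / (1 - (\<beta> * r\<^sup>2)\<^sup>2)) \<longlongrightarrow> 1 / \<rho>\<^sup>2) (at_right 0)"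
      by (rule tendsto_eq_intros refl | simp)+
    have "((\<lambda>r. (\<Sum>j=1..N. e j * (\<rho> ^ (2*j) - r ^ (2*j)))) \<longlongrightarrow> (\<Sum>j=1..N. e j * (\<rho> ^ (2*j) - 0 ^ (2*j)))) (at_right 0)"
      by (intro tendsto_intros)
    also have "(\<Sum>j=1..N. e j * (\<rho> ^ (2*j) - 0 ^ (2*j))) = (\<Sum>j=1..N. e j * \<rho> ^ (2*j))"
      by (intro sum.cong) auto
    finally show "((\<lambda>r. (\<Sum>j=1..N. e j * (\<rho> ^ (2*j) - r ^ (2*j)))) \<longlongrightarrow> (\<Sum>j=1..N. e j * \<rho> ^ (2*j))) (at_right 0)" .
    have "((\<lambda>r. \<beta> * r\<^sup>2) \<longlongrightarrow> \<beta> * 0\<^sup>2) (at_right 0)" by (intro tendsto_intros)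
    hence "eventually (\<lambda>r. \<beta> * r\<^sup>2 < 1) (at_right 0)" by (rule order_tendstoD) simp
    moreover have "eventually (\<lambda>r. r \<in> {0<..<min (1/2) \<rho>}) (at_right 0)"
      using \<rho> by (intro eventually_at_right_real) auto
    ultimately show "\<forall>\<^sub>F r in at_right 0. (\<Sum>j=1..N. e j * (\<rho> ^ (2*j) - r ^ (2*j))) 
         \<le> 1 / \<rho>\<^sup>2 + 4 * M * r + 4 * M\<^sup>2 * r ^ 4 / (1 - (\<beta> * r\<^sup>2)\<^sup>2)"
      by eventually_elim (rule annulus, use \<rho> in auto)
  qed
  have "(\<Sum>j=1..N. e j) \<le> 1"
  proof (rule tendsto_le[OF trivial_limit_at_left_real])
    have "((\<lambda>\<rho>::real. 1 / \<rho>\<^sup>2) \<longlongrightarrow> 1 / 1\<^sup>2) (at_left 1)" by (intro tendsto_intros) auto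
    thus "((\<lambda>\<rho>::real. 1 / \<rho>\<^sup>2) \<longlongrightarrow> 1) (at_left 1)" by simp
    have "((\<lambda>\<rho>. (\<Sum>j=1..N. e j * \<rho> ^ (2*j))) \<longlongrightarrow> (\<Sum>j=1..N. e j * 1 ^ (2*j))) (at_left 1)"
      by (intro tendsto_intros)
    thus "((\<lambda>\<rho>. (\<Sum>j=1..N. e j * \<rho> ^ (2*j))) \<longlongrightarrow> (\<Sum>j=1..N. e j)) (at_left 1)" by simp
    have "eventually (\<lambda>\<rho>::real. \<rho> \<in> {0<..<1}) (at_left 1)" by (intro eventually_at_left_real) simp
    thus "\<forall>\<^sub>F \<rho> in at_left 1. (\<Sum>j=1..N. e j * \<rho> ^ (2*j)) \<le> 1 / \<rho>\<^sup>2"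
      by eventually_elim (rule disc, auto)
  qed
  thus ?thesis by (simp add: e_def G_def)
qed

section \<open>A bound for the second coefficient\<close>

text \<open>The sharp bound is 2; anything below \<open>5/2\<close> serves equally well for half-integers.  For real coefficients it follows from the
area theorem by the intermediate value theorem: at the point \<open>x = \<plusminus> 1/sqrt 2\<close> where
\<open>G\<^sub>1 x < 0\<close>, the terms of \<open>G\<close> of degree at least 2 contribute at most \<open>|x|\<close>
by the Cauchy-Schwarz inequality, so \<open>|G\<^sub>1| \<ge> 5/2\<close> would make \<open>G(x)\<close> negative.  As \<open>G(0) = 1\<close>, the function
\<open>G = z/f\<close> would have a zero in the disc.\<close>

lemma second_coefficient_bound:
  assumes f: "f \<in> class_S" and real: "\<And>k. fps_nth (reciprocal_fps f) k \<in> \<real>"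
  shows "cmod (fps_nth (reciprocal_fps f) 1) < 5 / 2"
proof (rule ccontr)
  define G where "G = reciprocal_fps f"
  define b where "b = (\<lambda>k. Re (fps_nth G k))"
  have Gb: "fps_nth G k = of_real (b k)" for k
    using real[of k] by (simp add: b_def G_def of_real_Re)
  assume "\<not> cmod (fps_nth (reciprocal_fps f) 1) < 5 / 2"
  hence b1: "\<bar>b 1\<bar> \<ge> 5 / 2" by (simp flip: G_def add: Gb)
  obtain g where g: "g holomorphic_on ball 0 1" "g has_fps_expansion G" "g 0 = 1" 
      "\<And>z. cmod z < 1 \<Longrightarrow> g z \<noteq> 0"
    using class_S_reciprocal[OF f] unfolding G_def by metis
  have b0: "b 0 = 1" using has_fps_expansion_imp_0_eq_fps_nth_0[OF g(2)] g(3) by (simp add: b_def)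
  have sums: "(\<lambda>k. of_real (b k * x ^ k)) sums g (of_real x)" if "\<bar>x\<bar> < 1" for x
    using has_fps_expansion_imp_sums_complex[OF g(2), of 1 "of_real x"] g(1) that
    by (simp add: Gb one_ereal_def)
  have g_real: "g (of_real x) = of_real (Re (g (of_real x)))" if "\<bar>x\<bar> < 1" for x
  proof -
    have "(\<lambda>k. Im (of_real (b k * x ^ k))) sums Im (g (of_real x))" by (rule sums_Im[OF sums[OF that]])
    hence "(\<lambda>k. 0) sums Im (g (of_real x))" by simp
    hence "Im (g (of_real x)) = 0" using sums_unique by force
    thus ?thesis by (simp add: complex_eq_iff)
  qed
  \<comment> \<open>With \<open>x\<^sup>2 = 1/2\<close> one has \<open>\<Sum> x\<^sup>2\<^sup>k = 1/2 = x\<^sup>2\<close> over \<open>k \<ge> 2\<close>, and \<open>1 - (5/2) |x| + |x| < 0\<close> since \<open>|x| > 2/3\<close>.\<close>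
  define x where "x = - sgn (b 1) * sqrt (1 / 2)"
  have x2: "x\<^sup>2 = 1 / 2" using b1 by (auto simp: x_def power_mult_distrib sgn_if)
  have absx: "\<bar>x\<bar> = sqrt (1 / 2)" using x2 by (metis real_sqrt_abs)
  have absx_bounds: "2 / 3 < \<bar>x\<bar>" "\<bar>x\<bar> < 1"
    using x2 power2_less_imp_less[of "2 / 3" "\<bar>x\<bar>"] abs_square_less_1[of x] by (simp_all add: power2_eq_square)
  have "(\<lambda>k. Re (of_real (b k * x ^ k))) sums Re (g (of_real x))" by (rule sums_Re[OF sums[OF absx_bounds(2)]])
  hence "(\<lambda>k. b k * x ^ k) sums Re (g (of_real x))" by simp
  hence lim: "(\<lambda>N. \<Sum>k<N+2. b k * x ^ k) \<longlonglongrightarrow> Re (g (of_real x))"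
    unfolding sums_def by (rule LIMSEQ_ignore_initial_segment)
  have partial: "(\<Sum>k<N+2. b k * x ^ k) \<le> 1 - 5 / 2 * \<bar>x\<bar> + \<bar>x\<bar>" for N
  proof -
    have b1x: "b 1 * x = - (\<bar>b 1\<bar> * \<bar>x\<bar>)"
      unfolding absx x_def by (simp add: sgn_if)
    have "(\<Sum>j=1..N. b (Suc j) * x ^ Suc j)\<^sup>2 \<le> (\<Sum>j=1..N. (b (Suc j))\<^sup>2) * (\<Sum>j=1..N. (x ^ Suc j)\<^sup>2)"
      by (rule Cauchy_Schwarz_ineq_sum)
    also have "\<dots> \<le> 1 * (1/2)"
    proof (rule mult_mono)
      have "(\<Sum>j=1..N. (b (Suc j))\<^sup>2) \<le> (\<Sum>j=1..N. real j * (cmod (fps_nth (reciprocal_fps f) (Suc j)))\<^sup>2)"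
        by (intro sum_mono) (auto simp flip: G_def simp: Gb mult_le_cancel_right1)
      thus "(\<Sum>j=1..N. (b (Suc j))\<^sup>2) \<le> 1" using area_theorem[OF f, of N] by simp
      have "(x ^ Suc j)\<^sup>2 = (1/2) ^ Suc j" for j
        by (simp only: x2[symmetric] power_mult[symmetric] mult.commute)
      hence "(\<Sum>j=1..N. (x ^ Suc j)\<^sup>2) = (\<Sum>j=1..N. (1/2) ^ Suc j)" by (simp only:)
      also have "\<dots> = (\<Sum>j<N. (1/2) ^ Suc (Suc j))"
        by (rule sum.reindex_bij_witness[of _ Suc "\<lambda>j. j - 1"]) auto
      also have "\<dots> = (\<Sum>j<N. (1/2) ^ j) * (1/4)"
        unfolding sum_distrib_right by simp
      also have "\<dots> \<le> 2 * (1/4)" by (simp add: sum_gp_strict)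
      finally show "(\<Sum>j=1..N. (x ^ Suc j)\<^sup>2) \<le> 1/2" by simp
    qed (auto intro: sum_nonneg)
    finally have "(\<Sum>j=1..N. b (Suc j) * x ^ Suc j)\<^sup>2 \<le> \<bar>x\<bar>\<^sup>2" using x2 by simp
    hence "(\<Sum>j=1..N. b (Suc j) * x ^ Suc j) \<le> \<bar>x\<bar>"
      by (smt (verit) power2_le_iff_abs_le real_sqrt_abs real_sqrt_le_iff)
    moreover have "(\<Sum>k<N+2. b k * x ^ k) = 1 + b 1 * x + (\<Sum>j=1..N. b (Suc j) * x ^ Suc j)"
    proof -
      have "(\<Sum>j=1..N. b (Suc j) * x ^ Suc j) = (\<Sum>k<N. b (Suc (Suc k)) * x ^ Suc (Suc k))"
        by (rule sum.reindex_bij_witness[of _ Suc "\<lambda>j. j - 1"]) auto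
      thus ?thesis by (simp add: sum.lessThan_Suc_shift b0 del: sum.lessThan_Suc)
    qed
    moreover have "\<bar>b 1\<bar> * \<bar>x\<bar> \<ge> 5/2 * \<bar>x\<bar>" using b1 by (intro mult_right_mono) auto
    ultimately show ?thesis using b1x by simp
  qed
  have "Re (g (of_real x)) \<le> 1 - 5 / 2 * \<bar>x\<bar> + \<bar>x\<bar>"
    using lim partial by (intro LIMSEQ_le_const2) auto
  hence neg: "Re (g (of_real (1 * x))) < 0" using absx_bounds by simp
  have "\<exists>t\<ge>0. t \<le> 1 \<and> Re (g (of_real (t * x))) = 0"
  proof (rule IVT2')
    have "\<bar>t * x\<bar> < 1" if "t \<in> {0..1}" for t
      using that absx_bounds mult_left_le_one_le[of "\<bar>x\<bar>" t] by (simp add: abs_mult)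
    thus "continuous_on {0..1} (\<lambda>t. Re (g (of_real (t * x))))"
      by (intro continuous_intros continuous_on_compose2[OF holomorphic_on_imp_continuous_on[OF g(1)]])
         (auto simp flip: of_real_mult)
  qed (use neg g(3) in auto)
  then obtain t where t: "0 \<le> t" "t \<le> 1" "Re (g (of_real (t * x))) = 0" by blast
  have "\<bar>t * x\<bar> < 1" using t absx_bounds mult_left_le_one_le[of "\<bar>x\<bar>" t] by (simp add: abs_mult)
  with g_real[of "t * x"] g(4)[of "of_real (t * x)"] t(3) show False 
    by (metis norm_of_real of_real_0)
qed

section \<open>Enumeration of the coefficient sequences allowed by the area theorem\<close>

text \<open>A node of the search tree consists of the integers \<open>a\<^sub>i = 2\<^sup>i A\<^sub>i\<close> and \<open>\<gamma>\<^sub>i = 2\<^sup>i G\<^sub>i\<close> for \<open>i < k\<close>, with \<open>A\<close>, \<open>G\<close> as in the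
introduction, and of the integer \<open>s = 4\<^sup>k\<^sup>-\<^sup>1 (1 - \<Sum> (i - 1) G\<^sub>i\<^sup>2)\<close>, which the area theorem requires to be
nonnegative.  The next \<open>a\<^sub>k\<close> is a multiple \<open>p m\<close> of \<open>p = 2\<^sup>k\<^sup>-\<^sup>1\<close>, and \<open>A G = 1\<close> gives \<open>\<gamma>\<^sub>k = c - p m\<close>.  From \<open>|G\<^sub>k| \<le> 1\<close>
one gets \<open>|c - p m| \<le> 2 p\<close>, so that five values of \<open>m\<close> have to be tried.\<close>

definition children :: "int list \<times> int list \<times> int \<Rightarrow> (int list \<times> int list \<times> int) list" where
  "children = (\<lambda>(as, gs, s).
     let k = length as; c = - sum_list (map2 (*) (tl gs) (rev (tl as))); p = 2 ^ (k - 1); q = c div p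
     in filter (\<lambda>(as, gs, s). 0 \<le> s)
          (map (\<lambda>m. let g = c - p * m in (as @ [p * m], gs @ [g], 4 * s - int (k - 1) * (g * g))) [q - 2..q + 2]))"

text \<open>The roots are the pairs \<open>A\<^sub>1 = m/2\<close>, \<open>G\<^sub>1 = -m/2\<close> with \<open>0 \<le> m \<le> 4\<close>; the sum in the area theorem
starts at \<open>i = 2\<close>, whence the slack 4.\<close>

primrec survivors :: "nat \<Rightarrow> (int list \<times> int list \<times> int) list" where
  "survivors 0 = map (\<lambda>m. ([1, m], [1, - m], 4)) [0..4]"
| "survivors (Suc k) = concat (map children (survivors k))"

text \<open>A pair of coefficient lists \<open>(P, Q)\<close> stands for the function \<open>f(z) = z P(z) / (2 Q(z))\<close>.  These are the functions of
the theorem with \<open>a\<^sub>2 > 0\<close>, and those with \<open>a\<^sub>2 = 0\<close>.\<close>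

definition quotient_cases :: "(int list \<times> int list) list" where
  "quotient_cases = [([2], [1]), ([2], [1, 0, 1]), ([2], [1, 0, -1]), ([2], [1, -1]), ([2], [1, -2, 1]), ([2], [1, -1, 1]),
     ([2, 1], [1]), ([2, 0, 1], [1, 0, 1]), ([2, 0, -1], [1, 0, -1]), ([2, -1], [1, -1]), ([2, 1], [1, 0, -1]), 
     ([2, -1], [1, -2, 1]), ([2, -1, 1], [1, -1, 1])]"

text \<open>These functions have a critical point in the disc.\<close>

definition ramified_cases :: "(int list \<times> int list) list" where
  "ramified_cases = [([2, 0, -1], [1]), ([2, 0, 1], [1]), ([2, 0, 0, -1], [1]), ([2, 0, 0, 1], [1]), ([2, -1], [1, -1, 1]),
     ([2, 1, 1], [1]), ([2, 2, 1], [1]), ([2, -2, 1], [1, -2, 2, -1]), ([2, -2, 1], [1, -2, 1]), ([2, 1], [1, -1])]"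

text \<open>These functions have a pole in the interval \<open>(0, 1)\<close>.\<close>

definition polar_cases :: "(int list \<times> int list) list" where
  "polar_cases = [([2, 2, 1], [1, 0, -1, -1]), ([2], [1, -1, -1]), ([2, 1, 1], [1, -1, 0, -1]),
     ([2, 1], [1, -1, -1]), ([2, -1, 1], [1, -2, 1, -1]), ([2, -1], [1, -2]),
     ([2, 0, -1], [1, -2, 0, 1]), ([2, 0, 1], [1, -2, 1, -1]), ([2, 0, 0, -1], [1, -2, 0, 0, 1]),
     ([2, 0, 0, 1], [1, -2, 0, 1, -1]), ([2], [1, -2]), ([2, 0, 0, 1], [1, -2, 0, 0, -1]),
     ([2, 0, 0, -1], [1, -2, 0, -1, 1]), ([2, 0, 1], [1, -2, 0, -1]), ([2, 0, -1], [1, -2, -1, 1]),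
     ([2], [1, -2, -1])]"

text \<open>These two functions have neither a pole nor a critical point in the disc, and they satisfy the area theorem with equality.  Still
they are not univalent.\<close>

definition trinomial_cases :: "(int list \<times> int list) list" where
  "trinomial_cases = [([2, 0, 0, 1], [1, 0, 0, 1]), ([2, 0, 0, -1], [1, 0, 0, -1])]"

definition candidates :: "(int list \<times> int list) list" where
  "candidates = quotient_cases @ ramified_cases @ trinomial_cases @ polar_cases"

text \<open>For a node \<open>(as, gs, s)\<close> with 13 entries this is \<open>4\<^sup>1\<^sup>2\<close> times the amount \<open>1 - \<Sum> (i - 1) G\<^sub>i\<^sup>2\<close>, summed over
\<open>2 \<le> i \<le> 9\<close>, that the area theorem leaves for the coefficients with \<open>i \<ge> 10\<close>.\<close>

definition tail_energy :: "int list \<Rightarrow> int \<Rightarrow> int" where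
  "tail_energy gs s = s + 144 * (gs ! 10)\<^sup>2 + 40 * (gs ! 11)\<^sup>2 + 11 * (gs ! 12)\<^sup>2"

text \<open>The first condition is \<open>2 A Q = P\<close> up to degree 12, scaled by powers of 2; the others are the
hypotheses of the rigidity lemma.\<close>

definition explains :: "int list \<times> int list \<times> int \<Rightarrow> int list \<times> int list \<Rightarrow> bool" where
  "explains = (\<lambda>(as, gs, s) (P, Q). 
     (\<forall>k\<in>set [0..<13]. 2 * sum_list (map (\<lambda>i. 2 ^ i * nth_default 0 Q i * as ! (k - i)) [0..<Suc k]) = 2 ^ k * nth_default 0 P k)
     \<and> length P \<le> 4 \<and> length Q \<le> 5 \<and> (sum_list (map abs P))\<^sup>2 * tail_energy gs s < 9 * 4 ^ 12)"

text \<open>The list gives the position in \<open>candidates\<close> of the quotient that belongs to each survivor, in the order in which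
the search finds them.\<close>

definition survivor_quotients :: "(int list \<times> int list) list" where
  "survivor_quotients = map ((!) candidates)
     [1, 13, 7, 15, 23, 0, 16, 24, 14, 8, 2, 17, 12, 6, 18, 9, 10, 5, 19, 20, 3, 21, 25, 26, 22, 11, 27, 28, 29, 30, 4, 31, 32, 33, 34, 35, 36, 37, 38, 39, 40]"

lemma survivors_explained: "list_all2 explains (survivors 11) survivor_quotients"
  by code_simp

lemma survivor_quotients_subset: "set survivor_quotients \<subseteq> set candidates"
proof -
  have "list_all (\<lambda>i. i < length candidates) [1, 13, 7, 15, 23, 0, 16, 24, 14, 8, 2, 17, 12, 6, 18, 9, 10, 5, 19, 20, 3, 21, 25, 26, 22, 11, 27, 28, 29, 30, 4, 31, 32, 33, 34, 35, 36, 37, 38, 39, 40]"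
    by code_simp
  thus ?thesis unfolding survivor_quotients_def list_all_iff by auto
qed

text \<open>The integer that the search carries along, computed from the whole sequence.\<close>

definition slack :: "(nat \<Rightarrow> int) \<Rightarrow> nat \<Rightarrow> int" where
  "slack \<gamma> k = 4 ^ k - (\<Sum>j=2..k. (int j - 1) * (\<gamma> j)\<^sup>2 * 4 ^ (k - j))"

lemma slack_Suc: 
  assumes "k \<ge> 1"
  shows "slack \<gamma> (Suc k) = 4 * slack \<gamma> k - int k * (\<gamma> (Suc k))\<^sup>2"
proof -
  have "(\<Sum>j=2..k. (int j - 1) * (\<gamma> j)\<^sup>2 * 4 ^ (Suc k - j)) = 4 * (\<Sum>j=2..k. (int j - 1) * (\<gamma> j)\<^sup>2 * 4 ^ (k - j))"
    unfolding sum_distrib_left by (intro sum.cong refl) (simp add: Suc_diff_le)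
  thus ?thesis using assms by (simp add: slack_def)
qed

lemma slack_le: "slack \<gamma> k \<le> 4 ^ k"
  by (auto simp: slack_def intro!: sum_nonneg mult_nonneg_nonneg)

text \<open>The search is exhaustive: it finds every beginning of every sequence that satisfies \<open>A G = 1\<close> and the area
theorem.\<close>

lemma in_survivors:
  fixes a \<gamma> :: "nat \<Rightarrow> int"
  assumes a0: "a 0 = 1" and \<gamma>0: "\<gamma> 0 = 1"
    and conv: "\<And>k. k \<ge> 1 \<Longrightarrow> (\<Sum>i\<le>k. \<gamma> i * a (k - i)) = 0"
    and dvd: "\<And>k. k \<ge> 1 \<Longrightarrow> 2 ^ (k - 1) dvd a k"
    and a1: "0 \<le> a 1" "a 1 \<le> 4"
    and slack: "\<And>k. 0 \<le> slack \<gamma> k"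
  shows "(map a [0..<k+2], map \<gamma> [0..<k+2], slack \<gamma> (k+1)) \<in> set (survivors k)"
proof (induction k)
  case 0
  have "\<gamma> 1 = - a 1" using conv[of 1] a0 \<gamma>0 by simp
  moreover have "slack \<gamma> 1 = 4" by (simp add: slack_def)
  moreover have "[0..<0+2] = [0, 1::nat]" by (simp add: numeral_2_eq_2)
  ultimately show ?case using a0 \<gamma>0 a1 by simp
next
  case (Suc k)
  define K where "K = k + 2"
  define p :: int where "p = 2 ^ (K - 1)"
  define c where "c = - sum_list (map2 (*) (tl (map \<gamma> [0..<K])) (rev (tl (map a [0..<K]))))"
  have p: "p > 0" by (simp add: p_def)
  have c: "c = a K + \<gamma> K"
  proof -
    have "sum_list (map2 (*) (tl (map \<gamma> [0..<K])) (rev (tl (map a [0..<K])))) = (\<Sum>i<k+1. \<gamma> (Suc i) * a (K - Suc i))"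
      by (simp add: sum_list_sum_nth K_def atLeast0LessThan nth_tl rev_nth Suc_diff_le del: upt_Suc cong: sum.cong_simp)
    moreover have "(\<Sum>i\<le>K. \<gamma> i * a (K - i)) = a K + (\<Sum>i<k+1. \<gamma> (Suc i) * a (K - Suc i)) + \<gamma> K"
    proof -
      have "(\<Sum>i\<le>K. \<gamma> i * a (K - i)) = (\<Sum>i<Suc (Suc (k+1)). \<gamma> i * a (K - i))"
        by (simp add: K_def lessThan_Suc_atMost)
      also have "\<dots> = (\<Sum>i<Suc (k+1). \<gamma> i * a (K - i)) + \<gamma> K"
        by (subst sum.lessThan_Suc) (simp add: K_def a0)
      also have "(\<Sum>i<Suc (k+1). \<gamma> i * a (K - i)) = a K + (\<Sum>i<k+1. \<gamma> (Suc i) * a (K - Suc i))"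
        by (subst sum.lessThan_Suc_shift) (simp add: \<gamma>0)
      finally show ?thesis .
    qed
    ultimately show ?thesis using conv[of K] by (simp add: c_def K_def)
  qed
  have sl: "slack \<gamma> K = 4 * slack \<gamma> (k+1) - int (K - 1) * (\<gamma> K * \<gamma> K)"
    using slack_Suc[of "k+1" \<gamma>] by (simp add: K_def power2_eq_square)
  obtain m where m: "a K = p * m" using dvd[of K] by (auto simp: K_def p_def)
  have "\<bar>\<gamma> K\<bar> \<le> 2 * p"
  proof -
    have "1 * (\<gamma> K * \<gamma> K) \<le> int (K - 1) * (\<gamma> K * \<gamma> K)"
      by (intro mult_right_mono) (auto simp: K_def)
    also have "\<dots> \<le> 4 * slack \<gamma> (k + 1)" using sl slack[of K] by simp
    also have "\<dots> \<le> 4 * 4 ^ (k+1)" using slack_le[of \<gamma> "k+1"] by simp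
    also have "\<dots> = (2 * p)\<^sup>2"
      by (simp add: p_def K_def power2_eq_square flip: power_mult_distrib)
    finally have "(\<gamma> K)\<^sup>2 \<le> (2 * p)\<^sup>2" by (simp add: power2_eq_square)
    thus ?thesis using p abs_le_square_iff[of "\<gamma> K" "2 * p"] by simp
  qed
  moreover have "p * (m - c div p) = c mod p - \<gamma> K"
    using c m by (simp add: right_diff_distrib minus_mult_div_eq_mod[symmetric])
  moreover have "0 \<le> c mod p" "c mod p < p" using p by simp_all
  ultimately have "p * (m - c div p) < p * 3" "p * (-3) < p * (m - c div p)"
    using p by linarith+
  hence "m - c div p < 3" "-3 < m - c div p"
    using p by (simp_all only: mult_less_cancel_left_pos)
  hence mq: "m \<in> set [c div p - 2..c div p + 2]" by simp
  have step: "(map a [0..<K] @ [p * m], map \<gamma> [0..<K] @ [c - p * m], 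
       4 * slack \<gamma> (k+1) - int (K - 1) * ((c - p * m) * (c - p * m))) \<in> 
     set (children (map a [0..<K], map \<gamma> [0..<K], slack \<gamma> (k+1)))"
  proof -
    have "0 \<le> 4 * slack \<gamma> (k+1) - int (K - 1) * ((c - p * m) * (c - p * m))"
      using slack[of K] sl c m by simp
    thus ?thesis using mq
      unfolding children_def Let_def prod.case length_map length_upt minus_nat.diff_0 
        c_def[symmetric] p_def[symmetric] by auto
  qed
  have "(map a [0..<Suc k + 2], map \<gamma> [0..<Suc k + 2], slack \<gamma> (Suc k + 1)) =
        (map a [0..<K] @ [p * m], map \<gamma> [0..<K] @ [c - p * m], 
       4 * slack \<gamma> (k+1) - int (K - 1) * ((c - p * m) * (c - p * m)))"
    using sl c m by (simp add: K_def)
  with step Suc.IH show ?case by (auto simp: K_def simp del: upt_Suc)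
qed

section \<open>Rational functions determined by finitely many coefficients\<close>

definition list_poly :: "int list \<Rightarrow> 'a::comm_ring_1 poly" where
  "list_poly xs = Poly (map of_int xs)"

lemma coeff_list_poly: "coeff (list_poly xs) k = of_int (nth_default 0 xs k)"
  by (simp add: list_poly_def nth_default_def)

lemma list_poly_simps [simp]: "list_poly [] = 0" "list_poly (x # xs) = pCons (of_int x) (list_poly xs)"
  by (simp_all add: list_poly_def)

lemma sum_abs_nth_default:
  "length xs \<le> n \<Longrightarrow> (\<Sum>i<n. \<bar>nth_default 0 xs i\<bar>) = sum_list (map abs (xs :: int list))"
proof -
  assume n: "length xs \<le> n"
  have "(\<Sum>i<n. \<bar>nth_default 0 xs i\<bar>) = (\<Sum>i<length xs. \<bar>nth_default 0 xs i\<bar>)"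
    using n by (intro sum.mono_neutral_right) (auto simp: nth_default_def)
  also have "\<dots> = sum_list (map abs xs)"
    by (simp add: sum_list_sum_nth atLeast0LessThan nth_default_def)
  finally show ?thesis .
qed

text \<open>Let \<open>E = 2 A Q - P\<close>, a series with integral coefficients, and let \<open>n\<close> be the index of its first nonzero coefficient.
As \<open>G\<close> has constant term 1, this is also the coefficient of \<open>E G = 2 Q - P G\<close>, and since \<open>n\<close> exceeds
the degree of \<open>Q\<close> it is a combination of \<open>G\<^sub>n\<^sub>-\<^sub>3, \<dots>, G\<^sub>n\<close> with coefficients from \<open>P\<close>.  All these \<open>G\<^sub>i\<close> have \<open>i \<ge> 10\<close>, so
the energy \<open>\<tau>\<close> left for them bounds the coefficient by a number less than 1.\<close>

lemma quotient_rigidity: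
  fixes A G :: "complex fps" and P Q :: "int list"
  assumes AG: "A * G = 1" and A0: "fps_nth A 0 = 1"
    and half: "\<And>k. \<exists>m::int. fps_nth A k = of_int m / 2"
    and prefix: "\<And>k. k < 13 \<Longrightarrow> fps_nth (2 * A * fps_of_poly (list_poly Q)) k = fps_nth (fps_of_poly (list_poly P)) k"
    and len: "length P \<le> 4" "length Q \<le> 5"
    and bound: "\<And>k. k \<ge> 10 \<Longrightarrow> 9 * (cmod (fps_nth G k))\<^sup>2 \<le> \<tau>"
    and small: "(of_int (sum_list (map abs P)))\<^sup>2 * \<tau> < 9"
  shows "2 * A * fps_of_poly (list_poly Q) = fps_of_poly (list_poly P)"
proof -
  define E where "E = 2 * A * fps_of_poly (list_poly Q) - fps_of_poly (list_poly P)"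
  have G0: "fps_nth G 0 = 1" 
    using arg_cong[OF AG, of "\<lambda>F. fps_nth F 0"] A0 by simp
  have E_int: "fps_nth E n \<in> \<int>" for n
  proof -
    have 2: "fps_nth (2 * A) i \<in> \<int>" for i
    proof -
      obtain m :: int where "fps_nth A i = of_int m / 2" using half by blast
      hence "fps_nth (2 * A) i = of_int m" by (simp add: numeral_fps_const mult.commute)
      thus ?thesis by simp
    qed
    have "fps_nth (2 * A * fps_of_poly (list_poly Q)) n = (\<Sum>i=0..n. fps_nth (2 * A) i * of_int (nth_default 0 Q (n - i)))"
      by (subst fps_mult_nth) (simp only: fps_of_poly_nth coeff_list_poly)
    hence "fps_nth (2 * A * fps_of_poly (list_poly Q)) n \<in> \<int>"
      by (simp only:) (intro Ints_sum Ints_mult 2 Ints_of_int)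
    thus ?thesis by (simp add: E_def coeff_list_poly)
  qed
  have "fps_nth E n = 0" for n
  proof (induction n rule: less_induct)
    case (less n)
    show ?case
    proof (cases "n < 13")
      case True
      thus ?thesis using prefix by (simp add: E_def)
    next
      case False
      have "E * G = 2 * fps_of_poly (list_poly Q) - fps_of_poly (list_poly P) * G"
        using AG by (simp add: E_def algebra_simps)
      moreover have "fps_nth (E * G) n = fps_nth E n"
      proof -
        have "fps_nth (E * G) n = (\<Sum>i\<in>{0..n}. if i = n then fps_nth E n else 0)"
          unfolding fps_mult_nth by (intro sum.cong) (use less.IH G0 in auto)
        thus ?thesis by simp
      qed
      moreover have "fps_nth (2 * fps_of_poly (list_poly Q) :: complex fps) n = 0"
        using False len(2) by (simp add: numeral_fps_const coeff_list_poly nth_default_def)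
      moreover have "fps_nth (fps_of_poly (list_poly P) * G) n = (\<Sum>i<4. of_int (nth_default 0 P i) * fps_nth G (n - i))"
      proof -
        have "fps_nth (fps_of_poly (list_poly P) * G) n = (\<Sum>i\<in>{0..n}. of_int (nth_default 0 P i) * fps_nth G (n - i))"
          by (simp add: fps_mult_nth coeff_list_poly)
        also have "\<dots> = (\<Sum>i<4. of_int (nth_default 0 P i) * fps_nth G (n - i))"
          using False len(1) by (intro sum.mono_neutral_right) (auto simp: nth_default_def)
        finally show ?thesis .
      qed
      ultimately have E_eq: "fps_nth E n = - (\<Sum>i<4. of_int (nth_default 0 P i) * fps_nth G (n - i))"
        by simp
      define s where "s = sqrt (\<tau> / 9)"
      have s: "cmod (fps_nth G k) \<le> s" if "k \<ge> 10" for k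
        unfolding s_def using bound[OF that] by (intro real_le_rsqrt) simp
      have "cmod (fps_nth E n) \<le> (\<Sum>i<4. cmod (of_int (nth_default 0 P i) * fps_nth G (n - i)))"
        unfolding E_eq norm_minus_cancel by (rule norm_sum)
      also have "\<dots> \<le> (\<Sum>i<4. of_int \<bar>nth_default 0 P i\<bar> * s)"
        using False s by (intro sum_mono) (simp add: norm_mult mult_left_mono)
      also have "\<dots> = of_int (sum_list (map abs P)) * s"
        unfolding sum_distrib_right[symmetric] of_int_sum[symmetric] sum_abs_nth_default[OF len(1)] ..
      finally have le: "cmod (fps_nth E n) \<le> of_int (sum_list (map abs P)) * s" .
      have "0 \<le> 9 * (cmod (fps_nth G 10))\<^sup>2" by simp
      also have "\<dots> \<le> \<tau>" by (rule bound) simp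
      finally have "\<tau> \<ge> 0" .
      hence "(of_int (sum_list (map abs P)) * s)\<^sup>2 < 1\<^sup>2"
        using small by (simp add: s_def power_mult_distrib)
      hence "of_int (sum_list (map abs P)) * s < 1" by (rule power_less_imp_less_base) simp
      with le have "cmod (fps_nth E n) < 1" by simp
      with E_int[of n] show ?thesis by (auto elim!: Ints_cases)
    qed
  qed
  hence "E = 0" by (simp add: fps_eq_iff)
  thus ?thesis by (simp add: E_def)
qed

lemma half_integer_coefficients:
  assumes f: "f \<in> class_S"
    and half: "\<And>n. n \<ge> 2 \<Longrightarrow> fps_nth (fps_expansion f 0) n \<in> half_integers"
  shows "\<exists>m::int. fps_nth (fps_shift 1 (fps_expansion f 0)) k = of_int m / 2"
proof (cases k)
  case 0
  thus ?thesis using class_S_fps_expansion(3)[OF f] by (intro exI[of _ 2]) simp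
next
  case (Suc j)
  thus ?thesis using half[of "j + 2"] by (auto simp: half_integers_def)
qed

text \<open>If \<open>A(2z)\<close> is an integral series with constant term 1, so is its reciprocal.\<close>

lemma scaled_reciprocal_integral:
  fixes A G :: "complex fps" and a :: "nat \<Rightarrow> int"
  assumes AG: "A * G = 1" and a: "\<And>k. of_int (a k) = 2 ^ k * fps_nth A k" and a0: "a 0 = 1"
  obtains \<gamma> :: "nat \<Rightarrow> int" where "\<And>k. of_int (\<gamma> k) = 2 ^ k * fps_nth G k" "\<gamma> 0 = 1"
    "\<And>k. k \<ge> 1 \<Longrightarrow> (\<Sum>i\<le>k. \<gamma> i * a (k - i)) = 0"
proof -
  have conv: "(\<Sum>i\<le>k. (2 ^ i * fps_nth G i) * of_int (a (k - i))) = (if k = 0 then 1 else 0)" for k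
  proof -
    have "(\<Sum>i\<le>k. (2 ^ i * fps_nth G i) * of_int (a (k - i))) = (\<Sum>i\<le>k. 2 ^ k * (fps_nth G i * fps_nth A (k - i)))"
    proof (intro sum.cong refl)
      fix i assume "i \<in> {..k}"
      hence "(2::complex) ^ i * 2 ^ (k - i) = 2 ^ k" by (simp flip: power_add)
      thus "2 ^ i * fps_nth G i * of_int (a (k - i)) = 2 ^ k * (fps_nth G i * fps_nth A (k - i))"
        unfolding a by (simp add: mult_ac)
    qed
    also have "\<dots> = 2 ^ k * fps_nth (G * A) k"
      by (simp add: fps_mult_nth sum_distrib_left atLeast0AtMost)
    also have "G * A = 1" using AG by (simp add: mult.commute)
    finally show ?thesis by simp
  qed
  have "2 ^ k * fps_nth G k \<in> \<int>" for k
  proof (induction k rule: less_induct)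
    case (less k)
    show ?case
    proof (cases "k = 0")
      case True
      thus ?thesis using conv[of 0] a0 by simp
    next
      case False
      then obtain j where k: "k = Suc j" by (cases k) auto
      have "(\<Sum>i\<le>j. (2 ^ i * fps_nth G i) * of_int (a (k - i))) \<in> \<int>"
        by (intro Ints_sum Ints_mult less.IH) (auto simp: k)
      moreover have "2 ^ k * fps_nth G k = - (\<Sum>i\<le>j. (2 ^ i * fps_nth G i) * of_int (a (k - i)))"
        using conv[of k] a0 by (simp add: k add_eq_0_iff)
      ultimately show ?thesis by simp
    qed
  qed
  hence "\<exists>c::int. of_int c = 2 ^ k * fps_nth G k" for k
    unfolding Ints_def by (metis image_iff)
  hence "\<exists>\<gamma>. \<forall>k. of_int (\<gamma> k) = 2 ^ k * fps_nth G k" by (intro choice allI)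
  then obtain \<gamma> :: "nat \<Rightarrow> int" where \<gamma>: "\<And>k. of_int (\<gamma> k) = 2 ^ k * fps_nth G k" by blast
  have int_conv: "(\<Sum>i\<le>k. \<gamma> i * a (k - i)) = (if k = 0 then 1 else 0)" for k
  proof -
    have "(of_int (\<Sum>i\<le>k. \<gamma> i * a (k - i)) :: complex) = of_int (if k = 0 then 1 else 0)"
      using conv[of k] by (simp add: \<gamma>)
    thus ?thesis by (simp only: of_int_eq_iff)
  qed
  show ?thesis
    using that[OF \<gamma>] int_conv[of 0] int_conv a0 by simp
qed

text \<open>The beginning of \<open>A\<close> is found by the search, hence agrees with a candidate, and by rigidity the agreement extends
to the whole series.\<close>

lemma rational_representation:
  assumes f: "f \<in> class_S"
    and half: "\<And>n. n \<ge> 2 \<Longrightarrow> fps_nth (fps_expansion f 0) n \<in> half_integers"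
    and nonneg: "0 \<le> Re (fps_nth (fps_expansion f 0) 2)"
  shows "\<exists>(P, Q)\<in>set candidates. \<forall>z\<in>unit_disc. 2 * f z * poly (list_poly Q) z = z * poly (list_poly P) z"
proof -
  note F = class_S_fps_expansion[OF f]
  define A where "A = fps_shift 1 (fps_expansion f 0)"
  define G where "G = reciprocal_fps f"
  have A0: "fps_nth A 0 = 1" using F(3) by (simp add: A_def)
  have AG: "A * G = 1" unfolding G_def reciprocal_fps_def A_def[symmetric]
    using A0 by (intro inverse_mult_eq_1') simp
  have A_half: "\<exists>m::int. fps_nth A k = of_int m / 2" for k
    using half_integer_coefficients[OF f half] by (simp add: A_def)
  then obtain m :: "nat \<Rightarrow> int" where m: "\<And>k. fps_nth A k = of_int (m k) / 2" by metis
  define a :: "nat \<Rightarrow> int" where "a = (\<lambda>k. if k = 0 then 1 else 2 ^ (k - 1) * m k)"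
  have a: "of_int (a k) = 2 ^ k * fps_nth A k" for k
    using A0 by (cases k) (simp_all add: a_def m)
  obtain \<gamma> :: "nat \<Rightarrow> int" where \<gamma>: "\<And>k. of_int (\<gamma> k) = 2 ^ k * fps_nth G k" "\<gamma> 0 = 1"
    "\<And>k. k \<ge> 1 \<Longrightarrow> (\<Sum>i\<le>k. \<gamma> i * a (k - i)) = 0"
    using scaled_reciprocal_integral[OF AG a] by (auto simp: a_def)
  have G\<gamma>: "fps_nth G k = of_real (of_int (\<gamma> k) / 2 ^ k)" for k
    using \<gamma>(1)[of k] by (simp add: field_simps)
  define e where "e = (\<lambda>j. (real j - 1) * (cmod (fps_nth G j))\<^sup>2)"
  have e_eq: "e j = (real j - 1) * (of_int (\<gamma> j))\<^sup>2 / 4 ^ j" for j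
  proof -
    have "((2::real) ^ j)\<^sup>2 = 4 ^ j" by (simp add: power2_eq_square flip: power_mult_distrib)
    thus ?thesis unfolding e_def G\<gamma> norm_of_real by (simp add: power_divide)
  qed
  have e_nonneg: "e j \<ge> 0" if "j \<ge> 2" for j using that by (simp add: e_def)
  have energy: "(\<Sum>j=2..k. e j) \<le> 1" for k
  proof -
    have "(\<Sum>j=2..k. e j) = (\<Sum>n=1..k-1. real n * (cmod (fps_nth G (Suc n)))\<^sup>2)"
      by (rule sum.reindex_bij_witness[of _ Suc "\<lambda>j. j - 1"]) (auto simp: e_def)
    thus ?thesis using area_theorem[OF f, of "k - 1"] by (simp add: G_def)
  qed
  have slack_eq: "of_int (slack \<gamma> k) = 4 ^ k * (1 - (\<Sum>j=2..k. e j))" for k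
  proof -
    have "4 ^ k * (\<Sum>j=2..k. e j) = (\<Sum>j=2..k. (real j - 1) * (of_int (\<gamma> j))\<^sup>2 * 4 ^ (k - j))"
      unfolding sum_distrib_left by (intro sum.cong refl) (simp add: e_eq power_diff)
    thus ?thesis by (simp add: slack_def right_diff_distrib)
  qed
  have slack_nonneg: "0 \<le> slack \<gamma> k" for k
  proof -
    have "(0::real) \<le> of_int (slack \<gamma> k)" using energy[of k] by (simp add: slack_eq)
    thus ?thesis by simp
  qed
  have "\<gamma> 1 = - a 1" using \<gamma>(2) \<gamma>(3)[of 1] by (simp add: a_def)
  moreover have "\<bar>\<gamma> 1\<bar> < 5"
  proof -
    have "cmod (fps_nth G 1) < 5 / 2" unfolding G_def
      by (rule second_coefficient_bound[OF f]) (simp flip: G_def add: G\<gamma>)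
    thus ?thesis unfolding G\<gamma> norm_of_real by simp
  qed
  moreover have "0 \<le> a 1"
  proof -
    have "fps_nth A 1 = fps_nth (fps_expansion f 0) 2" by (simp add: A_def numeral_2_eq_2)
    hence "0 \<le> Re (of_int (a 1))" using nonneg by (simp add: a)
    thus ?thesis by simp
  qed
  ultimately have state: "(map a [0..<13], map \<gamma> [0..<13], slack \<gamma> 12) \<in> set (survivors 11)"
    using in_survivors[of a \<gamma> 11] \<gamma>(2,3) slack_nonneg by (simp add: a_def del: upt_rec_numeral)
  then obtain P Q where PQ: "(P, Q) \<in> set candidates" "explains (map a [0..<13], map \<gamma> [0..<13], slack \<gamma> 12) (P, Q)"
  proof -
    obtain i where i: "i < length (survivors 11)" "survivors 11 ! i = (map a [0..<13], map \<gamma> [0..<13], slack \<gamma> 12)"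
      using state unfolding in_set_conv_nth by blast
    hence "explains (map a [0..<13], map \<gamma> [0..<13], slack \<gamma> 12) (survivor_quotients ! i)"
      using list_all2_nthD[OF survivors_explained i(1)] by simp
    moreover have "survivor_quotients ! i \<in> set candidates"
      using i(1) list_all2_lengthD[OF survivors_explained] survivor_quotients_subset by (auto intro: nth_mem)
    ultimately show ?thesis using that by (cases "survivor_quotients ! i") auto
  qed
  note ex = PQ(2)[unfolded explains_def prod.case]
  have "2 * A * fps_of_poly (list_poly Q) = fps_of_poly (list_poly P)"
  proof (rule quotient_rigidity[OF AG A0 A_half])
    fix k :: nat assume k: "k < 13"
    have "2 * (\<Sum>i\<le>k. 2 ^ i * nth_default 0 Q i * a (k - i)) = 2 ^ k * nth_default 0 P k"
      using ex k by (simp add: interv_sum_list_conv_sum_set_nat atLeast0LessThan lessThan_Suc_atMost del: upt_rec_numeral upt_Suc)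
    hence "of_int (2 * (\<Sum>i\<le>k. 2 ^ i * nth_default 0 Q i * a (k - i))) = (of_int (2 ^ k * nth_default 0 P k) :: complex)"
      by (simp only:)
    also have "of_int (2 * (\<Sum>i\<le>k. 2 ^ i * nth_default 0 Q i * a (k - i))) =
        (2 ^ k * fps_nth (2 * A * fps_of_poly (list_poly Q)) k :: complex)"
    proof -
      have "of_int (\<Sum>i\<le>k. 2 ^ i * nth_default 0 Q i * a (k - i)) = 
          2 ^ k * (\<Sum>i\<le>k. of_int (nth_default 0 Q i) * fps_nth A (k - i))"
        unfolding of_int_sum sum_distrib_left
      proof (intro sum.cong refl)
        fix i assume "i \<in> {..k}"
        hence pow: "(2::complex) ^ k = 2 ^ i * 2 ^ (k - i)" by (simp flip: power_add)
        show "of_int (2 ^ i * nth_default 0 Q i * a (k - i)) = 2 ^ k * (of_int (nth_default 0 Q i) * fps_nth A (k - i))"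
          unfolding pow of_int_mult a by simp
      qed
      also have "\<dots> = 2 ^ k * fps_nth (fps_of_poly (list_poly Q) * A) k"
        by (simp add: fps_mult_nth coeff_list_poly atLeast0AtMost)
      finally have "of_int (2 * (\<Sum>i\<le>k. 2 ^ i * nth_default 0 Q i * a (k - i))) =
          2 ^ k * (2 * fps_nth (fps_of_poly (list_poly Q) * A) k)" by simp
      moreover have "2 * A * fps_of_poly (list_poly Q) = fps_const 2 * (fps_of_poly (list_poly Q) * A)"
        by (simp only: numeral_fps_const mult_ac)
      ultimately show ?thesis by (simp only: fps_mult_left_const_nth)
    qed
    finally show "fps_nth (2 * A * fps_of_poly (list_poly Q)) k = fps_nth (fps_of_poly (list_poly P)) k"
      by (simp add: coeff_list_poly)
  next
    fix k :: nat assume k: "k \<ge> 10"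
    have "9 * (cmod (fps_nth G k))\<^sup>2 \<le> e k"
      unfolding e_def using k by (intro mult_right_mono) auto
    also have "e k \<le> 1 - (\<Sum>j=2..9. e j)"
    proof -
      have "(\<Sum>j=2..9. e j) + e k = (\<Sum>j\<in>insert k {2..9}. e j)" using k by simp
      also have "\<dots> \<le> (\<Sum>j=2..k. e j)"
        using k e_nonneg by (intro sum_mono2) auto
      finally show ?thesis using energy[of k] by simp
    qed
    finally show "9 * (cmod (fps_nth G k))\<^sup>2 \<le> 1 - (\<Sum>j=2..9. e j)" .
  next
    have "tail_energy (map \<gamma> [0..<13]) (slack \<gamma> 12) = 64 * slack \<gamma> 9"
      using slack_Suc[of 9 \<gamma>] slack_Suc[of 10 \<gamma>] slack_Suc[of 11 \<gamma>]
      by (simp add: tail_energy_def del: upt_rec_numeral)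
    hence "(sum_list (map abs P))\<^sup>2 * (64 * slack \<gamma> 9) < 9 * 4 ^ 12" using ex by simp
    hence "(of_int ((sum_list (map abs P))\<^sup>2 * (64 * slack \<gamma> 9)) :: real) < of_int (9 * 4 ^ 12)"
      by (simp only: of_int_less_iff)
    moreover define \<tau> where "\<tau> = 1 - (\<Sum>j=2..9. e j)"
    hence "of_int (slack \<gamma> 9) = 4 ^ 9 * \<tau>" by (simp only: slack_eq)
    ultimately have "(of_int (sum_list (map abs P)))\<^sup>2 * \<tau> < 9" by (simp add: mult.commute)
    thus "(of_int (sum_list (map abs P)))\<^sup>2 * (1 - (\<Sum>j=2..9. e j)) < 9"
      by (simp only: \<tau>_def)
  qed (use ex in auto)
  hence eq: "2 * (fps_X * A) * fps_of_poly (list_poly Q) = fps_X * fps_of_poly (list_poly P)"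
    by (simp add: mult_ac)
  have XA: "fps_X * A = fps_expansion f 0"
    using F(2) by (auto simp: fps_eq_iff A_def)
  have poly_exp: "poly p has_fps_expansion fps_of_poly p" for p :: "complex poly"
    by (simp add: has_fps_expansion_def)
  have "2 * f z * poly (list_poly Q) z - z * poly (list_poly P) z = 0" if "z \<in> unit_disc" for z
  proof -
    have "(\<lambda>z. 2 * f z * poly (list_poly Q) z - z * poly (list_poly P) z) has_fps_expansion
       2 * fps_expansion f 0 * fps_of_poly (list_poly Q) - fps_X * fps_of_poly (list_poly P)"
      by (intro fps_expansion_intros F(1) poly_exp)
    also have "2 * fps_expansion f 0 * fps_of_poly (list_poly Q) - fps_X * fps_of_poly (list_poly P) = 0"
      using eq by (simp add: XA)
    finally have "eval_fps 0 z = 2 * f z * poly (list_poly Q) z - z * poly (list_poly P) z"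
      using that by (intro has_fps_expansion_imp_eval_fps_eq[where r = 1])
        (auto intro!: holomorphic_intros class_S_D(1)[OF f])
    thus ?thesis by simp
  qed
  thus ?thesis using PQ(1) by (intro bexI[of _ "(P, Q)"]) auto
qed

section \<open>Exclusion of rational functions that are not univalent\<close>

lemma poly_list_poly_of_real:
  "poly (list_poly xs) (of_real x) = (of_real (poly (list_poly xs) x) :: complex)"
  by (induction xs) auto

text \<open>This keeps the numerator positive on \<open>(0, 1)\<close>, so that a zero of the denominator is a pole.\<close>

lemma list_poly_lower_bound:
  fixes x :: real
  assumes "0 \<le> x" "x \<le> 1"
  shows "- of_int (sum_list (map (\<lambda>c. max 0 (- c)) xs)) \<le> poly (list_poly xs) x"
proof (induction xs)
  case (Cons c xs)
  define n :: real where "n = of_int (sum_list (map (\<lambda>c. max 0 (- c)) xs))"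
  have "n \<ge> 0" unfolding n_def of_int_0_le_iff by (intro sum_list_nonneg) auto
  hence "x * n \<le> n" using assms by (simp add: mult_left_le_one_le)
  moreover have "x * (- n) \<le> x * poly (list_poly xs) x"
    using Cons.IH assms unfolding n_def by (intro mult_left_mono) auto
  moreover have "of_int (sum_list (map (\<lambda>c. max 0 (- c)) (c # xs))) = max 0 (- of_int c) + n"
    by (simp add: n_def of_int_max)
  ultimately show ?case by simp
qed simp

text \<open>The point \<open>9/10\<close> lies between the zero of \<open>Q\<close> in question and 1 in all the cases that occur.\<close>

lemma pole_impossible:
  assumes eq: "\<And>z. cmod z < 1 \<Longrightarrow> 2 * f z * poly (list_poly Q) z = z * poly (list_poly (2 # P)) z"
    and P: "sum_list (map (\<lambda>c. max 0 (- c)) P) \<le> 2"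
    and Q: "poly (list_poly Q) 0 > (0::real)" "poly (list_poly Q) (9 / 10) < (0::real)"
  shows False
proof -
  have "\<exists>x\<ge>0. x \<le> 9 / 10 \<and> poly (list_poly Q) x = (0::real)"
    by (rule IVT2') (use Q in \<open>auto intro!: continuous_intros\<close>)
  then obtain x :: real where x: "0 \<le> x" "x \<le> 9 / 10" "poly (list_poly Q) x = 0" by blast
  have "x \<noteq> 0" using x(3) Q(1) by auto
  have "of_real (poly (list_poly (2 # P)) x) = (0::complex)"
    using eq[of "of_real x"] x \<open>x \<noteq> 0\<close> by (simp add: poly_list_poly_of_real del: list_poly_simps)
  hence "2 + x * poly (list_poly P) x = 0" unfolding of_real_eq_0_iff by simp
  moreover have "poly (list_poly P) x \<ge> -2"
    using list_poly_lower_bound[of x P] P x by linarith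
  hence "x * poly (list_poly P) x \<ge> x * (-2)" using x by (intro mult_left_mono) auto
  ultimately show False using x by simp
qed

text \<open>The condition on \<open>w\<close> says that the numerator of the derivative of \<open>z P / (2 Q)\<close> vanishes there.\<close>

lemma critical_point_impossible:
  assumes f: "f \<in> class_S"
    and eq: "\<And>z. cmod z < 1 \<Longrightarrow> 2 * f z * poly Q z = z * poly P z"
    and w: "cmod w < 1" "poly Q w \<noteq> 0"
    and crit: "(poly P w + w * poly (pderiv P) w) * poly Q w = w * poly P w * poly (pderiv Q) w"
  shows False
proof -
  note D = class_S_D[OF f]
  have f': "(f has_field_derivative deriv f w) (at w)"
    using w by (intro holomorphic_derivI[OF D(1)]) auto
  have nz: "deriv f w \<noteq> 0"
    using holomorphic_injective_imp_regular[OF D(1) _ D(4)] w by auto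
  have "((\<lambda>z. 2 * f z * poly Q z) has_field_derivative 2 * deriv f w * poly Q w + 2 * f w * poly (pderiv Q) w) (at w)"
    by (rule derivative_eq_intros f' poly_DERIV refl)+ (simp add: algebra_simps)
  moreover have "((\<lambda>z. z * poly P z) has_field_derivative poly P w + w * poly (pderiv P) w) (at w)"
    by (rule derivative_eq_intros poly_DERIV refl)+ (simp add: algebra_simps)
  hence "((\<lambda>z. 2 * f z * poly Q z) has_field_derivative poly P w + w * poly (pderiv P) w) (at w)"
    by (rule has_field_derivative_transform_within_open[of _ _ _ "ball 0 1"]) (use w eq in auto)
  ultimately have "2 * deriv f w * poly Q w + 2 * f w * poly (pderiv Q) w = poly P w + w * poly (pderiv P) w"
    by (rule DERIV_unique)
  from arg_cong[OF this, of "\<lambda>x. x * poly Q w"]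
  have "2 * deriv f w * (poly Q w)\<^sup>2 + (2 * f w * poly Q w) * poly (pderiv Q) w = 
      (poly P w + w * poly (pderiv P) w) * poly Q w"
    by (simp add: power2_eq_square algebra_simps)
  hence "2 * deriv f w * (poly Q w)\<^sup>2 = 0" using crit eq[OF w(1)] by simp
  thus False using nz w by simp
qed

lemma quadratic_root_in_disc:
  fixes b c :: complex
  assumes "cmod c < 1"
  obtains z where "cmod z < 1" "z\<^sup>2 + b * z + c = 0"
proof -
  define s where "s = csqrt (b\<^sup>2 - 4 * c)"
  have s: "s\<^sup>2 = b\<^sup>2 - 4 * c" by (simp add: s_def)
  define z1 z2 where "z1 = (- b + s) / 2" and "z2 = (- b - s) / 2"
  have prod: "z1 * z2 = c" 
    using s by (simp add: z1_def z2_def field_simps power2_eq_square)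
  have "z1\<^sup>2 + b * z1 + c = 0" "z2\<^sup>2 + b * z2 + c = 0"
    unfolding prod[symmetric] by (simp_all add: z1_def z2_def field_simps power2_eq_square)
  moreover have "cmod z1 < 1 \<or> cmod z2 < 1"
  proof (rule ccontr)
    assume "\<not> (cmod z1 < 1 \<or> cmod z2 < 1)"
    hence "1 * 1 \<le> cmod z1 * cmod z2" by (intro mult_mono) auto
    thus False using assms by (simp flip: prod add: norm_mult)
  qed
  ultimately show ?thesis using that by blast
qed

text \<open>All zeros of these polynomials are roots of unity.\<close>

lemma cyclotomic_factors_nonzero:
  fixes z :: complex
  assumes "cmod z < 1"
  shows "1 - z \<noteq> 0" "1 + z \<noteq> 0" "1 - z\<^sup>2 \<noteq> 0" "1 + z\<^sup>2 \<noteq> 0" "1 - z + z\<^sup>2 \<noteq> 0" "1 + z + z\<^sup>2 \<noteq> 0" "1 + z ^ 3 \<noteq> 0" "1 - z ^ 3 \<noteq> 0"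
proof -
  have pow: "cmod (z ^ n) < 1" if "n > 0" for n
    using assms that by (simp add: norm_power power_less_one_iff)
  have plus: "1 + z ^ n \<noteq> 0" if "n > 0" for n
    using pow[OF that] by (metis add_eq_0_iff norm_minus_cancel norm_one order_less_irrefl)
  have minus: "1 - z ^ n \<noteq> 0" if "n > 0" for n
    using pow[OF that] by (metis eq_iff_diff_eq_0 norm_one order_less_irrefl)
  show "1 - z \<noteq> 0" "1 - z\<^sup>2 \<noteq> 0" "1 - z ^ 3 \<noteq> 0" using minus[of 1] minus[of 2] minus[of 3] by auto
  show "1 + z \<noteq> 0" "1 + z\<^sup>2 \<noteq> 0" "1 + z ^ 3 \<noteq> 0" using plus[of 1] plus[of 2] plus[of 3] by auto
  have "(1 + z) * (1 - z + z\<^sup>2) = 1 + z ^ 3" "(1 - z) * (1 + z + z\<^sup>2) = 1 - z ^ 3"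
    by (simp_all add: algebra_simps power2_eq_square power3_eq_cube)
  thus "1 - z + z\<^sup>2 \<noteq> 0" "1 + z + z\<^sup>2 \<noteq> 0"
    using plus[of 3] minus[of 3] by auto
qed

text \<open>For \<open>f(z) = z (2 + s z\<^sup>3) / (2 (1 + s z\<^sup>3))\<close> with \<open>s = \<plusminus>1\<close>, the equation \<open>f(z) = f(w)\<close> with \<open>z \<noteq> w\<close> depends only on
\<open>\<sigma> = s (z + w)\<close> and \<open>p = z w\<close> and reads \<open>2 + \<sigma>\<^sup>3 - 4 p \<sigma> + p\<^sup>3 = 0\<close>.  For \<open>\<sigma> = 11/10\<close> the left-hand side changes sign
between \<open>p = 9/10\<close> and \<open>p = 97/100\<close>.  Since \<open>\<sigma>\<^sup>2 < 4 p\<close>, the points \<open>z\<close> and \<open>w\<close> are complex conjugate, of modulus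
\<open>sqrt p < 1\<close>.\<close>

lemma trinomial_impossible:
  assumes f: "f \<in> class_S" and s: "s = 1 \<or> s = - 1"
    and eq: "\<And>z. cmod z < 1 \<Longrightarrow> 2 * f z * (1 + s * z ^ 3) = z * (2 + s * z ^ 3)"
  shows False
proof -
  have "\<exists>p::real. 9/10 \<le> p \<and> p \<le> 97/100 \<and> 2 + (11/10)^3 - 4 * p * (11/10) + p ^ 3 = 0"
    by (rule IVT2') (auto intro!: continuous_intros simp: power3_eq_cube)
  then obtain p :: real where p: "9/10 \<le> p" "p \<le> 97/100" "2 + (11/10)^3 - 4 * p * (11/10) + p ^ 3 = 0" by blast
  define y where "y = sqrt (p - (11/20)\<^sup>2)"
  have y: "y > 0" "y\<^sup>2 = p - (11/20)\<^sup>2" using p by (auto simp: y_def power2_eq_square)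
  define z where "z = s * Complex (11/20) y"
  define w where "w = s * Complex (11/20) (- y)"
  have ss: "s * s = 1" "cmod s = 1" using s by auto
  have sum: "s * (z + w) = 11/10" 
    using ss by (simp add: z_def w_def flip: distrib_left mult.assoc) (simp add: complex_eq_iff)
  have prod: "z * w = of_real p"
  proof -
    have "z * w = (s * s) * (Complex (11/20) y * Complex (11/20) (- y))" by (simp add: z_def w_def mult_ac)
    thus ?thesis using ss y(2) by (simp add: complex_eq_iff power2_eq_square)
  qed
  have "z \<noteq> w" using y(1) s by (auto simp: z_def w_def)
  have nz: "cmod z < 1" "cmod w < 1"
  proof -
    have "(cmod (Complex (11/20) y))\<^sup>2 < 1\<^sup>2" "(cmod (Complex (11/20) (- y)))\<^sup>2 < 1\<^sup>2"
      using y(2) p by (simp_all add: cmod_power2)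
    hence "cmod (Complex (11/20) y) < 1" "cmod (Complex (11/20) (- y)) < 1"
      by (auto intro: power_less_imp_less_base)
    thus "cmod z < 1" "cmod w < 1" using ss by (simp_all add: z_def w_def norm_mult)
  qed
  have Qnz: "1 + s * z ^ 3 \<noteq> 0" "1 + s * w ^ 3 \<noteq> 0"
    using cyclotomic_factors_nonzero(7,8)[OF nz(1)] cyclotomic_factors_nonzero(7,8)[OF nz(2)] s by auto
  have key: "z * (2 + s * z ^ 3) * (1 + s * w ^ 3) = w * (2 + s * w ^ 3) * (1 + s * z ^ 3)"
  proof -
    have "z * (2 + s * z ^ 3) * (1 + s * w ^ 3) - w * (2 + s * w ^ 3) * (1 + s * z ^ 3) =
        (z - w) * (2 + s * (z + w) ^ 3 - 4 * s * (z * w) * (z + w) + s * s * (z * w) ^ 3)"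
      by (simp add: algebra_simps power2_eq_square power3_eq_cube)
    also have "2 + s * (z + w) ^ 3 - 4 * s * (z * w) * (z + w) + s * s * (z * w) ^ 3 =
      2 + (s * (z + w)) ^ 3 - 4 * (z * w) * (s * (z + w)) + (z * w) ^ 3"
    proof -
      have "s ^ 3 = s" using ss by (simp add: power3_eq_cube)
      thus ?thesis using ss by (simp add: power_mult_distrib mult_ac)
    qed
    also have "\<dots> = of_real (2 + (11/10)^3 - 4 * p * (11/10) + p ^ 3)"
      unfolding sum prod by simp
    also have "\<dots> = 0" by (simp only: p(3) of_real_0)
    finally show ?thesis by simp
  qed
  have "f z = f w"
  proof -
    have "(2 * f z * (1 + s * z ^ 3)) * (1 + s * w ^ 3) = (2 * f w * (1 + s * w ^ 3)) * (1 + s * z ^ 3)"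
      using key eq[OF nz(1)] eq[OF nz(2)] by simp
    thus ?thesis using Qnz by simp
  qed
  thus False using inj_onD[OF class_S_D(4)[OF f]] nz \<open>z \<noteq> w\<close> by auto
qed

lemma polar_impossible:
  assumes mem: "(P, Q) \<in> set polar_cases"
    and eq: "\<And>z. cmod z < 1 \<Longrightarrow> 2 * f z * poly (list_poly Q) z = z * poly (list_poly P) z"
  shows False
proof -
  have "list_all (\<lambda>(P, Q). P \<noteq> [] \<and> hd P = 2 \<and> sum_list (map (\<lambda>c. max 0 (- c)) (tl P)) \<le> 2 \<and>
      poly (list_poly Q) 0 > (0::real) \<and> poly (list_poly Q) (9 / 10) < (0::real)) polar_cases"
    by (simp add: polar_cases_def)
  hence "P \<noteq> [] \<and> hd P = 2 \<and> sum_list (map (\<lambda>c. max 0 (- c)) (tl P)) \<le> 2 \<and>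
      poly (list_poly Q) 0 > (0::real) \<and> poly (list_poly Q) (9 / 10) < (0::real)"
    using mem unfolding list_all_iff by blast
  thus False using pole_impossible[where P = "tl P" and Q = Q and f = f] eq
    by (cases P) simp_all
qed

text \<open>Up to a constant factor, the numerator \<open>N\<close> of the derivative is one of the following: in five cases a quadratic polynomial
whose roots have product \<open>\<plusminus>2/3\<close>, in two cases \<open>w\<^sup>3 \<plusminus> 1/2\<close>, in two cases a quadratic polynomial with a root
\<open>\<plusminus>(sqrt 3 - 1)\<close>, and once a product of \<open>1 - w\<close> and a cubic polynomial.\<close>

lemma ramified_impossible:
  assumes f: "f \<in> class_S" and mem: "(P, Q) \<in> set ramified_cases"
    and eq: "\<And>z. cmod z < 1 \<Longrightarrow> 2 * f z * poly (list_poly Q) z = z * poly (list_poly P) z"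
  shows False
proof -
  define N :: "complex \<Rightarrow> complex" where
    "N = (\<lambda>w. (poly (list_poly P) w + w * poly (pderiv (list_poly P)) w) * poly (list_poly Q) w
       - w * poly (list_poly P) w * poly (pderiv (list_poly Q)) w)"
  have crit: False if "cmod w < 1" "poly (list_poly Q) w \<noteq> 0" "N w = 0" for w
  proof (rule critical_point_impossible[OF f eq that(1,2)])
    show "(poly (list_poly P) w + w * poly (pderiv (list_poly P)) w) * poly (list_poly Q) w
       = w * poly (list_poly P) w * poly (pderiv (list_poly Q)) w"
      using that(3) by (simp add: N_def)
  qed
  from mem[unfolded ramified_cases_def list.set] show False
  proof (elim insertE emptyE)
    assume 1: "(P, Q) = ([2, 0, -1], [1])"
    obtain w :: complex where w: "cmod w < 1" "w\<^sup>2 + 0 * w + (-2/3) = 0"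
      by (rule quadratic_root_in_disc[of "-2/3" 0]) auto
    have Q: "poly (list_poly Q) w \<noteq> 0"
      using 1  by (simp add: algebra_simps power2_eq_square power3_eq_cube)
    have N: "N w = - 3 * (w\<^sup>2 + 0 * w + (-2/3))"
      using 1 by (simp add: N_def pderiv_pCons algebra_simps power2_eq_square power3_eq_cube)
    show False by (rule crit[OF w(1) Q]) (simp only: N w(2), simp)
  next
    assume 2: "(P, Q) = ([2, 0, 1], [1])"
    obtain w :: complex where w: "cmod w < 1" "w\<^sup>2 + 0 * w + 2/3 = 0"
      by (rule quadratic_root_in_disc[of "2/3" 0]) auto
    have Q: "poly (list_poly Q) w \<noteq> 0"
      using 2  by (simp add: algebra_simps power2_eq_square power3_eq_cube)
    have N: "N w = 3 * (w\<^sup>2 + 0 * w + 2/3)"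
      using 2 by (simp add: N_def pderiv_pCons algebra_simps power2_eq_square power3_eq_cube)
    show False by (rule crit[OF w(1) Q]) (simp only: N w(2), simp)
  next
    assume 3: "(P, Q) = ([2, 0, 0, -1], [1])"
    define w :: complex where "w = of_real (root 3 (1/2))"
    have w3: "w ^ 3 = 1 / 2" by (simp add: w_def flip: of_real_power)
    have w: "cmod w < 1" by (simp add: w_def)
    have Q: "poly (list_poly Q) w \<noteq> 0"
      using 3  by (simp add: algebra_simps power2_eq_square power3_eq_cube)
    have N: "N w = - 4 * (w ^ 3 - 1 / 2)"
      using 3 by (simp add: N_def pderiv_pCons algebra_simps power2_eq_square power3_eq_cube)
    show False by (rule crit[OF w Q]) (simp only: N w3, simp)
  next
    assume 4: "(P, Q) = ([2, 0, 0, 1], [1])"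
    define w :: complex where "w = - of_real (root 3 (1/2))"
    have w3: "w ^ 3 = - 1 / 2" by (simp add: w_def flip: of_real_power)
    have w: "cmod w < 1" by (simp add: w_def)
    have Q: "poly (list_poly Q) w \<noteq> 0"
      using 4  by (simp add: algebra_simps power2_eq_square power3_eq_cube)
    have N: "N w = 4 * (w ^ 3 - (- 1 / 2))"
      using 4 by (simp add: N_def pderiv_pCons algebra_simps power2_eq_square power3_eq_cube)
    show False by (rule crit[OF w Q]) (simp only: N w3, simp)
  next
    assume 5: "(P, Q) = ([2, -1], [1, -1, 1])"
    define w :: complex where "w = of_real (sqrt 3 - 1)"
    have w2: "w\<^sup>2 + 2 * w - 2 = 0" 
      unfolding w_def by (simp add: power2_eq_square algebra_simps flip: of_real_mult)
    have w: "cmod w < 1" 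
    proof -
      have "1 < sqrt 3" "sqrt 3 < 2" by (auto intro: real_less_lsqrt)
      thus ?thesis unfolding w_def norm_of_real by simp
    qed
    have Q: "poly (list_poly Q) w \<noteq> 0"
      using 5 cyclotomic_factors_nonzero(5)[OF w] by (simp add: algebra_simps power2_eq_square power3_eq_cube)
    have N: "N w = - (w\<^sup>2 + 2 * w - 2)"
      using 5 by (simp add: N_def pderiv_pCons algebra_simps power2_eq_square power3_eq_cube)
    show False by (rule crit[OF w Q]) (simp only: N w2, simp)
  next
    assume 6: "(P, Q) = ([2, 1, 1], [1])"
    obtain w :: complex where w: "cmod w < 1" "w\<^sup>2 + 2/3 * w + 2/3 = 0"
      by (rule quadratic_root_in_disc[of "2/3" "2/3"]) auto
    have Q: "poly (list_poly Q) w \<noteq> 0"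
      using 6  by (simp add: algebra_simps power2_eq_square power3_eq_cube)
    have N: "N w = 3 * (w\<^sup>2 + 2/3 * w + 2/3)"
      using 6 by (simp add: N_def pderiv_pCons algebra_simps power2_eq_square power3_eq_cube)
    show False by (rule crit[OF w(1) Q]) (simp only: N w(2), simp)
  next
    assume 7: "(P, Q) = ([2, 2, 1], [1])"
    obtain w :: complex where w: "cmod w < 1" "w\<^sup>2 + 4/3 * w + 2/3 = 0"
      by (rule quadratic_root_in_disc[of "2/3" "4/3"]) auto
    have Q: "poly (list_poly Q) w \<noteq> 0"
      using 7  by (simp add: algebra_simps power2_eq_square power3_eq_cube)
    have N: "N w = 3 * (w\<^sup>2 + 4/3 * w + 2/3)"
      using 7 by (simp add: N_def pderiv_pCons algebra_simps power2_eq_square power3_eq_cube)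
    show False by (rule crit[OF w(1) Q]) (simp only: N w(2), simp)
  next
    assume 8: "(P, Q) = ([2, -2, 1], [1, -2, 2, -1])"
    obtain w :: complex where w: "cmod w < 1" "w\<^sup>2 + (-4/3) * w + 2/3 = 0"
      by (rule quadratic_root_in_disc[of "2/3" "-4/3"]) auto
    have nz: "(1 - w) * (1 - w + w\<^sup>2) \<noteq> 0" using cyclotomic_factors_nonzero(1,5)[OF w(1)] by simp
    have Q: "poly (list_poly Q) w \<noteq> 0"
      using 8 nz by (simp add: algebra_simps power2_eq_square power3_eq_cube)
    have N: "N w = 3 * (w\<^sup>2 + (-4/3) * w + 2/3)"
      using 8 by (simp add: N_def pderiv_pCons algebra_simps power2_eq_square power3_eq_cube)
    show False by (rule crit[OF w(1) Q]) (simp only: N w(2), simp)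
  next
    assume 9: "(P, Q) = ([2, -2, 1], [1, -2, 1])"
    \<comment> \<open>The cubic factor of \<open>N\<close> has a real root \<open>r\<close> between 2 and 3, and its three roots have product 2.
      Hence the other two have product \<open>2/r < 1\<close>.\<close>
    have "\<exists>r::real. 2 \<le> r \<and> r \<le> 3 \<and> 2 - 2 * r + 3 * r\<^sup>2 - r ^ 3 = 0"
      by (rule IVT2') (auto intro!: continuous_intros)
    then obtain r :: real where r: "2 \<le> r" "r \<le> 3" "2 - 2 * r + 3 * r\<^sup>2 - r ^ 3 = 0" by blast
    have "r \<noteq> 2" using r(3) by auto
    have c: "r\<^sup>2 - 3 * r + 2 = 2 / r" using r by (simp add: field_simps power2_eq_square power3_eq_cube)
    have "cmod (of_real (r\<^sup>2 - 3 * r + 2)) < 1" unfolding c norm_of_real using r \<open>r \<noteq> 2\<close> by simp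
    then obtain w :: complex where w: "cmod w < 1" "w\<^sup>2 + of_real (r - 3) * w + of_real (r\<^sup>2 - 3 * r + 2) = 0"
      using quadratic_root_in_disc by blast
    have r': "2 - 2 * of_real r + 3 * (of_real r)\<^sup>2 - (of_real r :: complex) ^ 3 = 0"
      using arg_cong[OF r(3), of "of_real :: real \<Rightarrow> complex"] by simp
    have "2 - 2 * w + 3 * w\<^sup>2 - w ^ 3 = - (w - of_real r) * (w\<^sup>2 + of_real (r - 3) * w + of_real (r\<^sup>2 - 3 * r + 2))"
      using r' by (simp add: algebra_simps power2_eq_square power3_eq_cube)
    hence cubic: "2 - 2 * w + 3 * w\<^sup>2 - w ^ 3 = 0" using w(2) by simp
    have nz: "(1 - w) * (1 - w) \<noteq> 0" using cyclotomic_factors_nonzero(1)[OF w(1)] by simp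
    have Q: "poly (list_poly Q) w \<noteq> 0"
      using 9 nz by (simp add: algebra_simps power2_eq_square power3_eq_cube)
    have N: "N w = (1 - w) * (2 - 2 * w + 3 * w\<^sup>2 - w ^ 3)"
      using 9 by (simp add: N_def pderiv_pCons algebra_simps power2_eq_square power3_eq_cube)
    show False by (rule crit[OF w(1) Q]) (simp only: N cubic, simp)
  next
    assume 10: "(P, Q) = ([2, 1], [1, -1])"
    define w :: complex where "w = of_real (1 - sqrt 3)"
    have w2: "w\<^sup>2 - 2 * w - 2 = 0" 
      unfolding w_def by (simp add: power2_eq_square algebra_simps flip: of_real_mult)
    have w: "cmod w < 1" 
    proof -
      have "1 < sqrt 3" "sqrt 3 < 2" by (auto intro: real_less_lsqrt)
      thus ?thesis unfolding w_def norm_of_real by simp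
    qed
    have Q: "poly (list_poly Q) w \<noteq> 0"
      using 10 cyclotomic_factors_nonzero(1)[OF w] by (simp add: algebra_simps power2_eq_square power3_eq_cube)
    have N: "N w = - (w\<^sup>2 - 2 * w - 2)"
      using 10 by (simp add: N_def pderiv_pCons algebra_simps power2_eq_square power3_eq_cube)
    show False by (rule crit[OF w Q]) (simp only: N w2, simp)
  qed
qed

section \<open>The functions in the list\<close>

definition listed_functions :: "complex \<Rightarrow> (complex \<Rightarrow> complex) set" where
  "listed_functions s = {\<lambda>z. z, \<lambda>z. z / (1 + s * z), \<lambda>z. z / (1 + s * z^2), \<lambda>z. z / (1 + s * z)^2,
     \<lambda>z. z / (1 + s * z + z^2), \<lambda>z. z + s * z^2 / 2, \<lambda>z. z * (2 + s * z) / (2 * (1 + s * z)),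
     \<lambda>z. z * (2 + s * z^2) / (2 * (1 + s * z^2)), \<lambda>z. z * (2 + s * z) / (2 * (1 - z^2)),
     \<lambda>z. z * (2 + s * z) / (2 * (1 + s * z)^2), \<lambda>z. z * (2 + s * z + z^2) / (2 * (1 + s * z + z^2))}"

lemma candidate_in_listed_functions:
  assumes f: "f \<in> class_S" and mem: "(P, Q) \<in> set candidates"
    and eq: "\<And>z. cmod z < 1 \<Longrightarrow> 2 * f z * poly (list_poly Q) z = z * poly (list_poly P) z"
  shows "\<exists>s\<in>{1, -1}. \<exists>R\<in>listed_functions s. \<forall>z\<in>unit_disc. f z = R z"
proof -
  have quot: "(P, Q) \<in> set quotient_cases"
  proof (rule ccontr)
    assume "(P, Q) \<notin> set quotient_cases"
    then consider "(P, Q) \<in> set ramified_cases" | "(P, Q) \<in> set polar_cases" 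
      | "P = [2, 0, 0, 1]" "Q = [1, 0, 0, 1]" | "P = [2, 0, 0, -1]" "Q = [1, 0, 0, -1]"
      using mem unfolding candidates_def trinomial_cases_def by auto
    thus False
    proof cases
      case 1 thus False using ramified_impossible[OF f _ eq] by blast
    next
      case 2 thus False using polar_impossible[OF _ eq] by blast
    next
      case 3
      have "2 * f z * (1 + 1 * z ^ 3) = z * (2 + 1 * z ^ 3)" if "cmod z < 1" for z
        using eq[OF that] 3 by (simp add: power3_eq_cube mult.assoc)
      thus False using trinomial_impossible[OF f, of 1] by blast
    next
      case 4
      have "2 * f z * (1 + (-1) * z ^ 3) = z * (2 + (-1) * z ^ 3)" if "cmod z < 1" for z
        using eq[OF that] 4 by (simp add: power3_eq_cube mult.assoc)
      thus False using trinomial_impossible[OF f, of "-1"] by blast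
    qed
  qed
  have polynomial: ?thesis if "Q = [1]" "s \<in> {1, -1}" "R \<in> listed_functions s"
      "\<And>z. z * poly (list_poly P) z / 2 = R z" for s R
  proof -
    have "f z = R z" if "z \<in> unit_disc" for z
      using eq[of z] that \<open>Q = [1]\<close> \<open>\<And>z. z * poly (list_poly P) z / 2 = R z\<close>[of z]
      by (simp add: field_simps)
    thus ?thesis using that by blast
  qed
  have quotient: ?thesis
    if s: "s \<in> {1, -1}" "(\<lambda>z. z * p z / (2 * q z)) \<in> listed_functions s"
      and pq: "\<And>z. poly (list_poly P) z = p z" "\<And>z. poly (list_poly Q) z = q z"
      and nz: "\<And>z. cmod z < 1 \<Longrightarrow> q z \<noteq> 0" for s p q
  proof -
    have "f z = z * p z / (2 * q z)" if "z \<in> unit_disc" for z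
      using eq[of z] nz[of z] that unfolding pq by (simp add: eq_divide_eq mult_ac)
    thus ?thesis using s by (intro bexI[of _ s] bexI[of _ "\<lambda>z. z * p z / (2 * q z)"]) auto
  qed
  have integral: ?thesis
    if s: "s \<in> {1, -1}" "(\<lambda>z. z / q z) \<in> listed_functions s" and "P = [2]"
      and q: "\<And>z. poly (list_poly Q) z = q z" and nz: "\<And>z. cmod z < 1 \<Longrightarrow> q z \<noteq> 0" for s q
  proof -
    have "(\<lambda>z. z * 2 / (2 * q z)) = (\<lambda>z. z / q z)" 
      using nonzero_mult_divide_mult_cancel_left[of "2::complex"] by (simp only: mult.commute[of _ 2]) simp
    thus ?thesis using s q nz \<open>P = [2]\<close> by (intro quotient[of s "\<lambda>z. 2" q]) simp_all
  qed
  note nz = cyclotomic_factors_nonzero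
  from quot[unfolded quotient_cases_def list.set] show ?thesis
  proof (elim insertE emptyE)
    assume "(P, Q) = ([2], [1])"
    hence PQ: "P = [2]" "Q = [1]" by simp_all
    show ?thesis
      by (rule polynomial[of 1 "\<lambda>z. z"]) (auto simp: PQ listed_functions_def power2_eq_square field_simps)
  next
    assume "(P, Q) = ([2], [1, 0, 1])"
    hence PQ: "P = [2]" "Q = [1, 0, 1]" by simp_all
    show ?thesis
    proof (rule integral[of "1" "\<lambda>z. 1 + 1 * z^2"])
      show "poly (list_poly Q) z = 1 + 1 * z^2" for z :: complex
        by (simp add: PQ power2_eq_square algebra_simps)
      show "1 + 1 * z^2 \<noteq> 0" if "cmod z < 1" for z :: complex using nz(4)[OF that] by simp
    qed (simp_all add: PQ(1) listed_functions_def)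
  next
    assume "(P, Q) = ([2], [1, 0, -1])"
    hence PQ: "P = [2]" "Q = [1, 0, -1]" by simp_all
    show ?thesis
    proof (rule integral[of "-1" "\<lambda>z. 1 + (-1) * z^2"])
      show "poly (list_poly Q) z = 1 + (-1) * z^2" for z :: complex
        by (simp add: PQ power2_eq_square algebra_simps)
      show "1 + (-1) * z^2 \<noteq> 0" if "cmod z < 1" for z :: complex using nz(3)[OF that] by simp
    qed (simp_all add: PQ(1) listed_functions_def)
  next
    assume "(P, Q) = ([2], [1, -1])"
    hence PQ: "P = [2]" "Q = [1, -1]" by simp_all
    show ?thesis
    proof (rule integral[of "-1" "\<lambda>z. 1 + (-1) * z"])
      show "poly (list_poly Q) z = 1 + (-1) * z" for z :: complex
        by (simp add: PQ power2_eq_square algebra_simps)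
      show "1 + (-1) * z \<noteq> 0" if "cmod z < 1" for z :: complex using nz(1)[OF that] by simp
    qed (simp_all add: PQ(1) listed_functions_def)
  next
    assume "(P, Q) = ([2], [1, -2, 1])"
    hence PQ: "P = [2]" "Q = [1, -2, 1]" by simp_all
    show ?thesis
    proof (rule integral[of "-1" "\<lambda>z. (1 + (-1) * z)^2"])
      show "poly (list_poly Q) z = (1 + (-1) * z)^2" for z :: complex
        by (simp add: PQ power2_eq_square algebra_simps)
      show "(1 + (-1) * z)^2 \<noteq> 0" if "cmod z < 1" for z :: complex using nz(1)[OF that] by simp
    qed (simp_all add: PQ(1) listed_functions_def)
  next
    assume "(P, Q) = ([2], [1, -1, 1])"
    hence PQ: "P = [2]" "Q = [1, -1, 1]" by simp_all
    show ?thesis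
    proof (rule integral[of "-1" "\<lambda>z. 1 + (-1) * z + z^2"])
      show "poly (list_poly Q) z = 1 + (-1) * z + z^2" for z :: complex
        by (simp add: PQ power2_eq_square algebra_simps)
      show "1 + (-1) * z + z^2 \<noteq> 0" if "cmod z < 1" for z :: complex using nz(5)[OF that] by simp
    qed (simp_all add: PQ(1) listed_functions_def)
  next
    assume "(P, Q) = ([2, 1], [1])"
    hence PQ: "P = [2, 1]" "Q = [1]" by simp_all
    show ?thesis
      by (rule polynomial[of 1 "\<lambda>z. z + 1 * z^2 / 2"]) (auto simp: PQ listed_functions_def power2_eq_square field_simps)
  next
    assume "(P, Q) = ([2, 0, 1], [1, 0, 1])"
    hence PQ: "P = [2, 0, 1]" "Q = [1, 0, 1]" by simp_all
    show ?thesis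
    proof (rule quotient[of "1" "\<lambda>z. 2 + 1 * z^2" "\<lambda>z. 1 + 1 * z^2"])
      show "poly (list_poly Q) z = 1 + 1 * z^2" "poly (list_poly P) z = 2 + 1 * z^2" for z :: complex
        by (simp_all add: PQ power2_eq_square algebra_simps)
      show "1 + 1 * z^2 \<noteq> 0" if "cmod z < 1" for z :: complex using nz(4)[OF that] by simp
    qed (simp_all add: listed_functions_def)
  next
    assume "(P, Q) = ([2, 0, -1], [1, 0, -1])"
    hence PQ: "P = [2, 0, -1]" "Q = [1, 0, -1]" by simp_all
    show ?thesis
    proof (rule quotient[of "-1" "\<lambda>z. 2 + (-1) * z^2" "\<lambda>z. 1 + (-1) * z^2"])
      show "poly (list_poly Q) z = 1 + (-1) * z^2" "poly (list_poly P) z = 2 + (-1) * z^2" for z :: complex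
        by (simp_all add: PQ power2_eq_square algebra_simps)
      show "1 + (-1) * z^2 \<noteq> 0" if "cmod z < 1" for z :: complex using nz(3)[OF that] by simp
    qed (simp_all add: listed_functions_def)
  next
    assume "(P, Q) = ([2, -1], [1, -1])"
    hence PQ: "P = [2, -1]" "Q = [1, -1]" by simp_all
    show ?thesis
    proof (rule quotient[of "-1" "\<lambda>z. 2 + (-1) * z" "\<lambda>z. 1 + (-1) * z"])
      show "poly (list_poly Q) z = 1 + (-1) * z" "poly (list_poly P) z = 2 + (-1) * z" for z :: complex
        by (simp_all add: PQ power2_eq_square algebra_simps)
      show "1 + (-1) * z \<noteq> 0" if "cmod z < 1" for z :: complex using nz(1)[OF that] by simp
    qed (simp_all add: listed_functions_def)
  next
    assume "(P, Q) = ([2, 1], [1, 0, -1])"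
    hence PQ: "P = [2, 1]" "Q = [1, 0, -1]" by simp_all
    show ?thesis
    proof (rule quotient[of "1" "\<lambda>z. 2 + 1 * z" "\<lambda>z. 1 - z^2"])
      show "poly (list_poly Q) z = 1 - z^2" "poly (list_poly P) z = 2 + 1 * z" for z :: complex
        by (simp_all add: PQ power2_eq_square algebra_simps)
      show "1 - z^2 \<noteq> 0" if "cmod z < 1" for z :: complex using nz(3)[OF that] by simp
    qed (simp_all add: listed_functions_def)
  next
    assume "(P, Q) = ([2, -1], [1, -2, 1])"
    hence PQ: "P = [2, -1]" "Q = [1, -2, 1]" by simp_all
    show ?thesis
    proof (rule quotient[of "-1" "\<lambda>z. 2 + (-1) * z" "\<lambda>z. (1 + (-1) * z)^2"])
      show "poly (list_poly Q) z = (1 + (-1) * z)^2" "poly (list_poly P) z = 2 + (-1) * z" for z :: complex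
        by (simp_all add: PQ power2_eq_square algebra_simps)
      show "(1 + (-1) * z)^2 \<noteq> 0" if "cmod z < 1" for z :: complex using nz(1)[OF that] by simp
    qed (simp_all add: listed_functions_def)
  next
    assume "(P, Q) = ([2, -1, 1], [1, -1, 1])"
    hence PQ: "P = [2, -1, 1]" "Q = [1, -1, 1]" by simp_all
    show ?thesis
    proof (rule quotient[of "-1" "\<lambda>z. 2 + (-1) * z + z^2" "\<lambda>z. 1 + (-1) * z + z^2"])
      show "poly (list_poly Q) z = 1 + (-1) * z + z^2" "poly (list_poly P) z = 2 + (-1) * z + z^2" for z :: complex
        by (simp_all add: PQ power2_eq_square algebra_simps)
      show "1 + (-1) * z + z^2 \<noteq> 0" if "cmod z < 1" for z :: complex using nz(5)[OF that] by simp
    qed (simp_all add: listed_functions_def)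
  qed
qed

lemma reflection_class_S:
  assumes f: "f \<in> class_S"
  shows "(\<lambda>z. - f (- z)) \<in> class_S"
    "fps_nth (fps_expansion (\<lambda>z. - f (- z)) 0) n = (-1) ^ Suc n * fps_nth (fps_expansion f 0) n"
proof -
  note D = class_S_D[OF f] and F = class_S_fps_expansion[OF f]
  have "(f \<circ> (\<lambda>z. - z)) has_fps_expansion fps_compose (fps_expansion f 0) (- fps_X)"
    by (intro has_fps_expansion_compose fps_expansion_intros F(1)) simp
  hence "(\<lambda>z. - f (- z)) has_fps_expansion - fps_compose (fps_expansion f 0) (- fps_X)"
    unfolding o_def by (rule has_fps_expansion_minus)
  hence exp: "fps_expansion (\<lambda>z. - f (- z)) 0 = - fps_compose (fps_expansion f 0) (- fps_X)"
    by (rule fps_expansion_eqI)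
  show nth: "fps_nth (fps_expansion (\<lambda>z. - f (- z)) 0) n = (-1) ^ Suc n * fps_nth (fps_expansion f 0) n" for n
    unfolding exp by (simp add: fps_compose_uminus')
  have "(\<lambda>z. - f (- z)) holomorphic_on unit_disc"
    by (intro holomorphic_intros holomorphic_on_compose_gen[OF _ D(1), unfolded o_def]) auto
  moreover have "deriv (\<lambda>z. - f (- z)) 0 = 1"
    using nth[of 1] F(3) by (simp add: fps_expansion_def)
  moreover have "inj_on (\<lambda>z. - f (- z)) unit_disc"
  proof (rule inj_onI)
    fix x y assume "x \<in> unit_disc" "y \<in> unit_disc" "- f (- x) = - f (- y)"
    hence "- x = - y" using inj_onD[OF D(4), of "- x" "- y"] by simp
    thus "x = y" by simp
  qed
  ultimately show "(\<lambda>z. - f (- z)) \<in> class_S"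
    using D(2) by (simp add: class_S_def class_A_def analytic_on_open)
qed

text \<open>The reflection \<open>R(z) \<mapsto> -R(-z)\<close> fixes the odd functions of the list and changes the sign \<open>s\<close> in the others.\<close>

lemma reflection_listed_functions:
  assumes "R \<in> listed_functions s"
  shows "(\<lambda>z. - R (- z)) \<in> listed_functions s \<union> listed_functions (- s)"
  using assms unfolding listed_functions_def by (elim insertE emptyE) simp_all

theorem theorem1p2:
  fixes f :: "complex \<Rightarrow> complex"
  assumes "f \<in> class_S"
    and "\<And>n. n \<ge> 2 \<Longrightarrow> fps_nth (fps_expansion f 0) n \<in> half_integers"
  shows
    "((\<forall>z\<in>unit_disc. f z = z) \<or>
      (\<exists>s\<in>{1, -1}.
        (\<forall>z\<in>unit_disc. f z = z / (1 + s * z)) \<or>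
        (\<forall>z\<in>unit_disc. f z = z / (1 + s * z^2)) \<or>
        (\<forall>z\<in>unit_disc. f z = z / (1 + s * z)^2) \<or>
        (\<forall>z\<in>unit_disc. f z = z / (1 + s * z + z^2)))) \<or>
     (\<exists>s\<in>{1, -1}.
        (\<forall>z\<in>unit_disc. f z = z + s * z^2 / 2) \<or>
        (\<forall>z\<in>unit_disc. f z = z * (2 + s * z) / (2 * (1 + s * z))) \<or>
        (\<forall>z\<in>unit_disc. f z = z * (2 + s * z^2) / (2 * (1 + s * z^2))) \<or>
        (\<forall>z\<in>unit_disc. f z = z * (2 + s * z) / (2 * (1 - z^2))) \<or>
        (\<forall>z\<in>unit_disc. f z = z * (2 + s * z) / (2 * (1 + s * z)^2)) \<or>
        (\<forall>z\<in>unit_disc. f z = z * (2 + s * z + z^2) / (2 * (1 + s * z + z^2))))"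
proof -
  have main: "\<exists>s\<in>{1, -1}. \<exists>R\<in>listed_functions s. \<forall>z\<in>unit_disc. h z = R z"
    if h: "h \<in> class_S" "\<And>n. n \<ge> 2 \<Longrightarrow> fps_nth (fps_expansion h 0) n \<in> half_integers"
      "0 \<le> Re (fps_nth (fps_expansion h 0) 2)" for h
  proof -
    obtain P Q where "(P, Q) \<in> set candidates"
      "\<forall>z\<in>unit_disc. 2 * h z * poly (list_poly Q) z = z * poly (list_poly P) z"
      using rational_representation[OF h] by blast
    thus ?thesis by (intro candidate_in_listed_functions[OF h(1)]) auto
  qed
  have "\<exists>s\<in>{1, -1}. \<exists>R\<in>listed_functions s. \<forall>z\<in>unit_disc. f z = R z"
  proof (cases "0 \<le> Re (fps_nth (fps_expansion f 0) 2)")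
    case True
    show ?thesis by (rule main[OF assms True])
  next
    case False
    have half: "- x \<in> half_integers" if x: "x \<in> half_integers" for x
    proof -
      obtain k :: int where "x = of_int k / 2" using x by (auto simp: half_integers_def)
      hence "- x = of_int (- k) / 2" by simp
      thus ?thesis unfolding half_integers_def by blast
    qed
    \<comment> \<open>The reflected function has second coefficient \<open>-a\<^sub>2 > 0\<close>.\<close>
    have "\<exists>s\<in>{1, -1}. \<exists>R\<in>listed_functions s. \<forall>z\<in>unit_disc. - f (- z) = R z"
    proof (rule main[OF reflection_class_S(1)[OF assms(1)]])
      fix n :: nat assume "n \<ge> 2"
      thus "fps_nth (fps_expansion (\<lambda>z. - f (- z)) 0) n \<in> half_integers"
        unfolding reflection_class_S(2)[OF assms(1)] 
        using assms(2)[of n] half[of "fps_nth (fps_expansion f 0) n"] by (cases "even n") simp_all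
    qed (use False in \<open>simp add: reflection_class_S(2)[OF assms(1)]\<close>)
    then obtain s R where s: "s \<in> {1, -1}" "R \<in> listed_functions s" and R: "\<forall>z\<in>unit_disc. - f (- z) = R z"
      by blast
    have "f z = - R (- z)" if "z \<in> unit_disc" for z
    proof -
      have "- f z = R (- z)" using R[rule_format, of "- z"] that by simp
      thus ?thesis by (metis minus_minus)
    qed
    moreover have "s \<in> {1, -1}" "- s \<in> {1, -1}" using s(1) by auto
    ultimately show ?thesis using reflection_listed_functions[OF s(2)]
      by (elim UnE) (intro bexI[of _ "\<lambda>z. - R (- z)"] bexI[of _ s] bexI[of _ "- s"]; blast)+
  qed
  thus ?thesis unfolding listed_functions_def by (simp only: bex_simps insert_iff) blast
qed

end
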